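(* For every integer $n\geq 1$, the space $Q_n$ is an Eilenberg--MacLane space, that is, a $K(\pi,1)$ with $\pi=\pi_1 Q_n$.
   Context: Let $S^1$ be the circle with a fixed point $\infty\in S^1$, let $T^{n-1}=\{(x_1,\ldots,x_{n-1})\mid x_i\in S^1\}$ be the $(n-1)$-dimensional torus and set $x_n=\infty$. For $1\leq i<j<k\leq n$ let $A_{ijk}\subset T^{n-1}$ be the subset of points satisfying $x_i=x_j=x_k$, and let $A_n=\bigcup_{1\leq i<j<k\leq n}A_{ijk}$. The space $Q_n$ is the complement $T^{n-1}\setminus A_n$ (the space of configurations of $n$ ordered points on the circle, no three of which coincide, with the last point fixed at $\infty$). *)

theory Defs
  imports "HOL-Analysis.Analysis" "HOL-Algebra.Elementary_Groups"
begin

definition cube :: "nat \<Rightarrow> (nat \<Rightarrow> real) topology" where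
  "cube k = product_topology (\<lambda>_. top_of_set {0..1}) {..<k}"

definition cube_boundary :: "nat \<Rightarrow> (nat \<Rightarrow> real) set" where
  "cube_boundary k = {t \<in> topspace (cube k). \<exists>i<k. t i = 0 \<or> t i = 1}"

definition spheroids :: "nat \<Rightarrow> 'a topology \<Rightarrow> 'a \<Rightarrow> ((nat \<Rightarrow> real) \<Rightarrow> 'a) set" where
  "spheroids k X x = {f. continuous_map (cube k) X f \<and> (\<forall>t\<in>cube_boundary k. f t = x)}"

definition spheroid_homotopy ::
    "nat \<Rightarrow> 'a topology \<Rightarrow> 'a \<Rightarrow> (((nat \<Rightarrow> real) \<Rightarrow> 'a) \<times> ((nat \<Rightarrow> real) \<Rightarrow> 'a)) set" where
  "spheroid_homotopy k X x =
     {(f, g). homotopic_with (\<lambda>h. \<forall>t\<in>cube_boundary k. h t = x) (cube k) X f g}"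

definition spheroid_concat ::
    "((nat \<Rightarrow> real) \<Rightarrow> 'a) \<Rightarrow> ((nat \<Rightarrow> real) \<Rightarrow> 'a) \<Rightarrow> (nat \<Rightarrow> real) \<Rightarrow> 'a" where
  "spheroid_concat f g t =
     (if t 0 \<le> 1/2 then f (t(0 := 2 * t 0)) else g (t(0 := 2 * t 0 - 1)))"

text \<open>
  The homotopy group \<open>\<pi>\<^sub>k(X, x)\<close>, meaningful for \<open>k \<ge> 1\<close> and \<open>x\<close> in the space. The product
  of two classes is written as a union over all representatives; as homotopy is compatible with
  concatenation, this union is a single class.
\<close>

definition homotopy_group ::
    "nat \<Rightarrow> 'a topology \<Rightarrow> 'a \<Rightarrow> ((nat \<Rightarrow> real) \<Rightarrow> 'a) set monoid" where
  "homotopy_group k X x =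
     \<lparr>carrier = spheroids k X x // spheroid_homotopy k X x,
      monoid.mult = (\<lambda>A B. \<Union>f\<in>A. \<Union>g\<in>B. spheroid_homotopy k X x `` {spheroid_concat f g}),
      one = spheroid_homotopy k X x `` {\<lambda>_. x}\<rparr>"

text \<open>The pointed space \<open>(X, x)\<close> is a \<open>K(G, m)\<close>, for \<open>m \<ge> 1\<close>.\<close>

definition eilenberg_maclane ::
    "'a topology \<Rightarrow> 'a \<Rightarrow> ('g, 'b) monoid_scheme \<Rightarrow> nat \<Rightarrow> bool" where
  "eilenberg_maclane X x G m \<longleftrightarrow>
     x \<in> topspace X \<and> path_connected_space X \<and>
     homotopy_group m X x \<cong> G \<and>
     (\<forall>k\<ge>1. k \<noteq> m \<longrightarrow> trivial_group (homotopy_group k X x))"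

abbreviation circle :: "complex set" where
  "circle \<equiv> sphere 0 1"

text \<open>
  Points of the \<open>(n - 1)\<close>-torus are functions on the index set \<open>{1..<n}\<close>, so the torus is a
  single point for \<open>n = 1\<close>.
\<close>

definition torus :: "nat \<Rightarrow> (nat \<Rightarrow> complex) topology" where
  "torus n = product_topology (\<lambda>_. top_of_set circle) {1..<n}"

text \<open>The \<open>n\<close> points \<open>x\<^sub>1, \<dots>, x\<^sub>n\<close> of a configuration, where \<open>x\<^sub>n = p\<close> is the fixed point.\<close>

definition config_point :: "nat \<Rightarrow> complex \<Rightarrow> (nat \<Rightarrow> complex) \<Rightarrow> nat \<Rightarrow> complex" where
  "config_point n p x i = (if i = n then p else x i)"

definition triple_diagonal ::
    "nat \<Rightarrow> complex \<Rightarrow> nat \<Rightarrow> nat \<Rightarrow> nat \<Rightarrow> (nat \<Rightarrow> complex) set" where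
  "triple_diagonal n p i j k =
     {x \<in> topspace (torus n).
        config_point n p x i = config_point n p x j \<and>
        config_point n p x j = config_point n p x k}"

definition triple_diagonals :: "nat \<Rightarrow> complex \<Rightarrow> (nat \<Rightarrow> complex) set" where
  "triple_diagonals n p =
     \<Union>{triple_diagonal n p i j k | i j k. 1 \<le> i \<and> i < j \<and> j < k \<and> k \<le> n}"

definition Q_space :: "nat \<Rightarrow> complex \<Rightarrow> (nat \<Rightarrow> complex) topology" where
  "Q_space n p = subtopology (torus n) (topspace (torus n) - triple_diagonals n p)"

end

theory Submission imports Defs begin

text \<open>
  Lift a configuration to real points \<open>z i\<close>, indexed by the integers with \<open>z (i + n) = z i + L\<close>. Up to
  relabelling, the consecutive gaps are nonnegative and no two adjacent ones vanish. Such gap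
  vectors form a chamber of the right-angled Coxeter group with one generator for each gap, two
  generators commuting iff the gaps are not adjacent. The translates of the chamber under the Tits
  representation of the group fill the interior \<open>U\<close> of the Tits cone, the set of vectors on which
  only finitely many positive roots are nonpositive. Folding a vector into the chamber and
  unfolding the result again by exchanges of neighbouring points of the configuration gives a map
  from \<open>U\<close> onto \<open>Q\<^sub>n\<close>, and the part of \<open>U\<close> where the length \<open>L\<close> is 1 is a covering space of \<open>Q\<^sub>n\<close>.
  Spheroids of dimension at least 2 lift to it, and they contract in \<open>U\<close>, which is convex.
\<close>

text \<open>For n \<ge> 3 the exchanges at two adjacent gaps satisfy a braid relation, so
  \<open>refl 1\<close> only sees the affine symmetric group and cannot detect loops around a triple
  collision. With those collisions removed, chambers of the configuration space meet only along
  faces where pairwise non-adjacent gaps vanish, and there commutations are the only relations.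
  Replacing the coefficient 1 by 2 keeps exactly these: adjacent reflections then generate an
  infinite dihedral group, no vector of \<open>U\<close> has two adjacent nonpositive coordinates,
  and the chambers around a removed collision are unrolled. Each action respects the commutations,
  which is why a vector folded by one may be unfolded by the other. The length of the unfolded
  vector is only piecewise linear on \<open>U\<close>, so segments between points of length 1 may
  leave that slice. Length 1 is imposed for the covering, whose fibres would otherwise contain all
  rescalings; the contraction runs in \<open>U\<close> and is pushed down by a map that divides by
  the length.\<close>

section \<open>Lifting\<close>

text \<open>This is the form of a covering that homotopy lifting uses: one neighbourhood
  \<open>V\<close> serves all points of the fibre, sections over it extend lifts, and local
  injectivity makes lifts unique.\<close>

locale sheeted =
  fixes E :: "'e::t2_space set" and B :: "'b topology" and \<pi> :: "'e \<Rightarrow> 'b"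
  assumes continuous: "continuous_map (top_of_set E) B \<pi>"
    and sections: "b \<in> topspace B \<Longrightarrow> \<exists>V. openin B V \<and> b \<in> V \<and> (\<forall>e\<in>E. \<pi> e \<in> V \<longrightarrow>
          (\<exists>\<sigma>. continuous_map (subtopology B V) (top_of_set E) \<sigma> \<and> (\<forall>x\<in>V. \<pi> (\<sigma> x) = x) \<and> \<sigma> (\<pi> e) = e))"
    and locally_injective: "e \<in> E \<Longrightarrow> \<exists>N. openin (top_of_set E) N \<and> e \<in> N \<and> inj_on \<pi> N"
begin

text \<open>Local injectivity makes the set of agreement open, and separation in \<open>E\<close>
  makes its complement open.\<close>

lemma lift_unique:
  fixes A :: "'a::topological_space set"
  assumes "connected A" and g: "continuous_map (top_of_set A) (top_of_set E) g"
    and h: "continuous_map (top_of_set A) (top_of_set E) h"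
    and eq: "\<And>s. s \<in> A \<Longrightarrow> \<pi> (g s) = \<pi> (h s)" and "a \<in> A" "g a = h a" "b \<in> A"
  shows "g b = h b"
proof (rule connected_induction_simple[OF \<open>connected A\<close> \<open>a \<in> A\<close> \<open>b \<in> A\<close>, of "\<lambda>s. g s = h s"])
  have pre: "openin (top_of_set A) {s \<in> A. k s \<in> W}"
    if "continuous_map (top_of_set A) (top_of_set E) k" "openin (top_of_set E) W" for k W
    using openin_continuous_map_preimage[OF that] by simp
  fix s assume s: "s \<in> A"
  have gh: "g s \<in> E" "h s \<in> E" using s g h by (auto simp: Pi_iff)
  show "\<exists>T. openin (top_of_set A) T \<and> s \<in> T \<and> (\<forall>x\<in>T. \<forall>y\<in>T. g x = h x \<longrightarrow> g y = h y)"
  proof (cases "g s = h s")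
    case True
    obtain N where N: "openin (top_of_set E) N" "g s \<in> N" "inj_on \<pi> N"
      using locally_injective gh by blast
    show ?thesis
    proof (intro exI conjI ballI impI)
      show "openin (top_of_set A) ({s \<in> A. g s \<in> N} \<inter> {s \<in> A. h s \<in> N})"
        using pre[OF g N(1)] pre[OF h N(1)] by blast
    qed (use N True s eq in \<open>auto dest: inj_onD\<close>)
  next
    case False
    then obtain U W where UW: "open U" "open W" "g s \<in> U" "h s \<in> W" "U \<inter> W = {}"
      using hausdorff[of "g s" "h s"] by metis
    have "openin (top_of_set E) (E \<inter> U)" "openin (top_of_set E) (E \<inter> W)"
      using UW by (auto simp: openin_open_Int)
    then have "openin (top_of_set A) ({s \<in> A. g s \<in> E \<inter> U} \<inter> {s \<in> A. h s \<in> E \<inter> W})"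
      using pre[OF g] pre[OF h] by blast
    then show ?thesis
      using UW gh s by (intro exI[of _ "{s \<in> A. g s \<in> E \<inter> U} \<inter> {s \<in> A. h s \<in> E \<inter> W}"] conjI) auto
  qed
qed fact

text \<open>\<open>Q s\<close> says that the lift exists up to time \<open>s\<close> over some
  neighbourhood of \<open>d\<close>, and it propagates along the connected interval. Near a time
  \<open>s0\<close> the values of \<open>f\<close> stay in one \<open>V\<close>, so a section over
  \<open>V\<close> prolongs any lift that has reached \<open>J0\<close>; \<open>mono\<close> handles
  the backward direction. The neighbourhood of \<open>d\<close> shrinks at each step.\<close>

lemma local_homotopy_lifting:
  fixes D :: "'d topology"
  assumes f: "continuous_map (prod_topology (top_of_set {0..1::real}) D) B f"
    and g0: "continuous_map D (top_of_set E) g0"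
    and f0: "\<And>x. x \<in> topspace D \<Longrightarrow> f (0, x) = \<pi> (g0 x)"
    and d: "d \<in> topspace D"
  shows "\<exists>N g. openin D N \<and> d \<in> N \<and>
    continuous_map (subtopology (prod_topology (top_of_set {0..1}) D) ({0..1} \<times> N)) (top_of_set E) g \<and>
    (\<forall>r\<in>{0..1}. \<forall>x\<in>N. \<pi> (g (r, x)) = f (r, x)) \<and> (\<forall>x\<in>N. g (0, x) = g0 x)"
proof -
  define I where "I = (top_of_set {0..1::real})"
  have I: "topspace I = {0..1}" by (simp add: I_def)
  define Q where "Q s \<longleftrightarrow> (\<exists>N g. openin D N \<and> d \<in> N \<and>
    continuous_map (subtopology (prod_topology I D) ({0..s} \<times> N)) (top_of_set E) g \<and>
    (\<forall>r\<in>{0..s}. \<forall>x\<in>N. \<pi> (g (r, x)) = f (r, x)) \<and> (\<forall>x\<in>N. g (0, x) = g0 x))" for s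
  have f: "continuous_map (prod_topology I D) B f" using f by (simp add: I_def)
  have mono: "Q s" if Qs: "Q s'" and ss: "s \<le> s'" for s s'
  proof -
    obtain N g where "openin D N" "d \<in> N"
      "continuous_map (subtopology (prod_topology I D) ({0..s'} \<times> N)) (top_of_set E) g"
      "\<forall>r\<in>{0..s'}. \<forall>x\<in>N. \<pi> (g (r, x)) = f (r, x)" "\<forall>x\<in>N. g (0, x) = g0 x"
      using Qs unfolding Q_def by blast
    then show ?thesis unfolding Q_def using ss
      by (intro exI[of _ N] exI[of _ g])
        (auto intro: continuous_map_from_subtopology_mono[where T = "{0..s'} \<times> N"])
  qed
  have "Q 1"
  proof (rule connected_induction_simple[of "{0..1::real}" 0 1])
    show "Q 0"
      unfolding Q_def
    proof (intro exI conjI)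
      show "continuous_map (subtopology (prod_topology I D) ({0..0} \<times> topspace D)) (top_of_set E) (g0 \<circ> snd)"
        by (intro continuous_map_from_subtopology continuous_map_compose[OF continuous_map_snd g0])
    qed (use d f0 in auto)
    fix s0 :: real assume s0: "s0 \<in> {0..1}"
    have "f (s0, d) \<in> topspace B"
      using continuous_map_funspace[OF f] s0 d by (auto simp: I Pi_iff)
    then obtain V where V: "openin B V" "f (s0, d) \<in> V" and sec: "\<And>e. e \<in> E \<Longrightarrow> \<pi> e \<in> V \<Longrightarrow>
          \<exists>\<sigma>. continuous_map (subtopology B V) (top_of_set E) \<sigma> \<and> (\<forall>x\<in>V. \<pi> (\<sigma> x) = x) \<and> \<sigma> (\<pi> e) = e"
      using sections by meson
    have "openin (prod_topology I D) {z \<in> topspace (prod_topology I D). f z \<in> V}"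
      using f V(1) openin_continuous_map_preimage by blast
    moreover have "(s0, d) \<in> {z \<in> topspace (prod_topology I D). f z \<in> V}"
      using s0 d V by (simp add: I)
    ultimately obtain J N0 where J: "openin I J" "s0 \<in> J" and N0: "openin D N0" "d \<in> N0"
      and JN: "J \<times> N0 \<subseteq> {z \<in> topspace (prod_topology I D). f z \<in> V}"
      unfolding openin_prod_topology_alt by meson
    obtain J' where J': "open J'" "J = {0..1} \<inter> J'"
      using J(1) unfolding I_def openin_open by blast
    obtain \<epsilon> where eps: "\<epsilon> > 0" "ball s0 \<epsilon> \<subseteq> J'" using J' J(2) by (metis IntE open_contains_ball)
    define J0 where "J0 = {0..1} \<inter> ball s0 \<epsilon>"
    have conv: "{s..s'} \<subseteq> J0" if "s \<in> J0" "s' \<in> J0" for s s'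
      using that by (auto simp: J0_def dist_real_def)
    have step: "Q s'" if s: "s \<in> J0" and s': "s' \<in> J0" and "s < s'" and Qs: "Q s" for s s'
    proof -
      obtain N g where N: "openin D N" "d \<in> N"
        and g: "continuous_map (subtopology (prod_topology I D) ({0..s} \<times> N)) (top_of_set E) g"
        and gl: "\<forall>r\<in>{0..s}. \<forall>x\<in>N. \<pi> (g (r, x)) = f (r, x)" and g_0: "\<forall>x\<in>N. g (0, x) = g0 x"
        using Qs unfolding Q_def by blast
      have s01: "0 \<le> s" "s \<le> 1" "s' \<le> 1" using s s' by (auto simp: J0_def)
      have ND: "N \<subseteq> topspace D" "N0 \<subseteq> topspace D" using N N0 openin_subset by auto
      have "g (s, d) \<in> E"
        using continuous_map_funspace[OF g] s01 N ND by (auto simp: I Pi_iff)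
      have J0J: "J0 \<subseteq> J" using eps J' by (auto simp: J0_def)
      have fV: "f (r, x) \<in> V" if "r \<in> J0" "x \<in> N0" for r x
        using JN J0J that by blast
      have pgV: "\<pi> (g (s, d)) \<in> V" using gl N N0 s s01 fV by auto
      obtain \<sigma> where sig: "continuous_map (subtopology B V) (top_of_set E) \<sigma>"
        and sig1: "\<And>x. x \<in> V \<Longrightarrow> \<pi> (\<sigma> x) = x" and sig2: "\<sigma> (\<pi> (g (s, d))) = g (s, d)"
        using sec[OF \<open>g (s, d) \<in> E\<close> pgV] by blast
      obtain O1 where O1: "openin (top_of_set E) O1" "g (s, d) \<in> O1" "inj_on \<pi> O1"
        using locally_injective[OF \<open>g (s, d) \<in> E\<close>] by blast
      define gs where "gs = (\<lambda>x. g (s, x))"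
      have cgs: "continuous_map (subtopology D N) (top_of_set E) gs"
      proof -
        have "continuous_map (subtopology D N) (subtopology (prod_topology I D) ({0..s} \<times> N)) (\<lambda>x. (s, x))"
          using s01 by (intro continuous_map_into_subtopology continuous_map_pairedI
              continuous_map_from_subtopology) (auto simp: I)
        from continuous_map_compose[OF this g] show ?thesis by (simp add: gs_def o_def)
      qed
      define M where "M = N \<inter> N0"
      have M: "openin D M" "d \<in> M" "M \<subseteq> N" "M \<subseteq> N0" "M \<subseteq> topspace D" using N N0 ND by (auto simp: M_def)
      have cgM: "continuous_map (subtopology D M) (top_of_set E) gs"
        using continuous_map_from_subtopology_mono[OF cgs M(3)] .
      have "continuous_map (subtopology D M) B (\<lambda>x. f (s, x))"
      proof -
        have "continuous_map (subtopology D M) (prod_topology I D) (\<lambda>x. (s, x))"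
          using s01 by (intro continuous_map_pairedI continuous_map_from_subtopology) (auto simp: I)
        from continuous_map_compose[OF this f] show ?thesis by (simp add: o_def)
      qed
      then have "continuous_map (subtopology D M) (subtopology B V) (\<lambda>x. f (s, x))"
        using fV s M by (intro continuous_map_into_subtopology) auto
      then have csf: "continuous_map (subtopology D M) (top_of_set E) (\<lambda>x. \<sigma> (f (s, x)))"
        using continuous_map_compose[OF _ sig] by (auto simp: o_def)
      \<comment> \<open>Over \<open>M1\<close> the old lift at time \<open>s\<close> and the section
        both lie in \<open>O1\<close>, where the projection is injective; hence they agree there and
        can be pasted at time \<open>s\<close>.\<close>
      define M1 where "M1 = {x \<in> topspace (subtopology D M). gs x \<in> O1} \<inter> {x \<in> topspace (subtopology D M). \<sigma> (f (s, x)) \<in> O1}"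
      have "openin (subtopology D M) M1"
        unfolding M1_def
        using openin_continuous_map_preimage[OF cgM O1(1)] openin_continuous_map_preimage[OF csf O1(1)]
        by (rule openin_Int)
      then have M1: "openin D M1" using M(1) openin_trans_full by blast
      have fsd: "f (s, d) = \<pi> (g (s, d))" using gl N s01 by auto
      have dM1: "d \<in> M1" using M d O1(2) sig2 fsd by (auto simp: M1_def gs_def)
      have M1M: "M1 \<subseteq> M" by (auto simp: M1_def)
      have agree: "g (s, x) = \<sigma> (f (s, x))" if "x \<in> M1" for x
      proof -
        have "\<pi> (g (s, x)) = f (s, x)" using gl that M1M M s01 by auto
        also have "\<dots> = \<pi> (\<sigma> (f (s, x)))" using sig1 fV s that M1M M by auto
        finally show ?thesis using O1(3) that by (auto simp: M1_def gs_def dest: inj_onD)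
      qed
      define X where "X = subtopology (prod_topology I D) ({0..s'} \<times> M1)"
      define g' where "g' = (\<lambda>z. if fst z \<le> s then g z else \<sigma> (f z))"
      have "continuous_map X (top_of_set E) g'"
        unfolding g'_def
      proof (rule continuous_map_cases_le)
        have "continuous_map X I fst"
          unfolding X_def by (intro continuous_map_from_subtopology continuous_map_fst)
        then show "continuous_map X euclideanreal fst"
          unfolding I_def using continuous_map_into_fulltopology by blast
        show "continuous_map X euclideanreal (\<lambda>z. s)" by simp
        show "continuous_map (subtopology X {x \<in> topspace X. fst x \<le> s}) (top_of_set E) g"
          unfolding X_def subtopology_subtopology
          by (rule continuous_map_from_subtopology_mono[OF g]) (use M1M M in \<open>auto simp: I\<close>)
        have "continuous_map (subtopology X {x \<in> topspace X. s \<le> fst x}) (subtopology B V) f"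
          unfolding X_def subtopology_subtopology
        proof (rule continuous_map_into_subtopology)
          show "f \<in> topspace (subtopology (prod_topology I D) ({0..s'} \<times> M1 \<inter>
            {x \<in> topspace (subtopology (prod_topology I D) ({0..s'} \<times> M1)). s \<le> fst x})) \<rightarrow> V"
          proof
            fix z assume "z \<in> topspace (subtopology (prod_topology I D) ({0..s'} \<times> M1 \<inter>
              {x \<in> topspace (subtopology (prod_topology I D) ({0..s'} \<times> M1)). s \<le> fst x}))"
            then have "fst z \<in> {s..s'}" "snd z \<in> M1" by auto
            then have "fst z \<in> J0" "snd z \<in> N0" using conv[OF s s'] M1M M by blast+
            then show "f z \<in> V" using fV[of "fst z" "snd z"] by simp
          qed
        qed (intro continuous_map_from_subtopology f)
        then show "continuous_map (subtopology X {x \<in> topspace X. s \<le> fst x}) (top_of_set E) (\<lambda>z. \<sigma> (f z))"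
          using continuous_map_compose[OF _ sig] by (auto simp: o_def)
        show "g z = \<sigma> (f z)" if "z \<in> topspace X" "fst z = s" for z
          using that agree by (cases z) (auto simp: X_def)
      qed
      moreover have "\<pi> (g' (r, x)) = f (r, x)" if "r \<in> {0..s'}" "x \<in> M1" for r x
      proof (cases "r \<le> s")
        case True then show ?thesis using gl that M1M M by (auto simp: g'_def)
      next
        case False
        then have "r \<in> J0" using conv[OF s s'] that by auto
        then show ?thesis using False sig1 fV that M1M M by (auto simp: g'_def)
      qed
      moreover have "g' (0, x) = g0 x" if "x \<in> M1" for x
        using g_0 s01 that M1M M by (auto simp: g'_def)
      ultimately show ?thesis unfolding Q_def X_def using M1 dM1 by blast
    qed
    show "\<exists>T. openin (top_of_set {0..1}) T \<and> s0 \<in> T \<and> (\<forall>x\<in>T. \<forall>y\<in>T. Q x \<longrightarrow> Q y)"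
    proof (intro exI conjI ballI impI)
      show "openin (top_of_set {0..1}) J0" by (auto simp: J0_def openin_open_Int)
      show "s0 \<in> J0" using s0 eps by (simp add: J0_def)
      show "Q y" if "x \<in> J0" "y \<in> J0" "Q x" for x y
        using step[of x y] mono[of x y] that by (cases "x < y") auto
    qed
  qed auto
  then show ?thesis unfolding Q_def I_def by blast
qed

text \<open>Two local lifts agree over the overlap of their neighbourhoods, because along each
  segment over a fixed \<open>x\<close> they lift the same path from the same start
  \<open>g0 x\<close>. So one may use over each \<open>x\<close> the lift chosen for
  \<open>x\<close> itself.\<close>

lemma homotopy_lifting:
  fixes D :: "'d topology"
  assumes f: "continuous_map (prod_topology (top_of_set {0..1::real}) D) B f"
    and g0: "continuous_map D (top_of_set E) g0"
    and f0: "\<And>x. x \<in> topspace D \<Longrightarrow> f (0, x) = \<pi> (g0 x)"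
  obtains g where "continuous_map (prod_topology (top_of_set {0..1::real}) D) (top_of_set E) g"
    "\<And>r x. r \<in> {0..1} \<Longrightarrow> x \<in> topspace D \<Longrightarrow> \<pi> (g (r, x)) = f (r, x)"
    "\<And>x. x \<in> topspace D \<Longrightarrow> g (0, x) = g0 x"
proof -
  define P where "P = prod_topology (top_of_set {0..1::real}) D"
  define R where "R d N g \<longleftrightarrow> openin D N \<and> d \<in> N \<and>
    continuous_map (subtopology P ({0..1} \<times> N)) (top_of_set E) g \<and>
    (\<forall>r\<in>{0..1}. \<forall>x\<in>N. \<pi> (g (r, x)) = f (r, x)) \<and> (\<forall>x\<in>N. g (0, x) = g0 x)" for d N g
  have "\<forall>d\<in>topspace D. \<exists>N g. R d N g"
    using local_homotopy_lifting[OF f g0 f0] unfolding P_def R_def by blast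
  then obtain N where "\<forall>d\<in>topspace D. \<exists>g. R d (N d) g" by (rule bchoice[THEN exE])
  then obtain g where R: "\<forall>d\<in>topspace D. R d (N d) (g d)" by (rule bchoice[THEN exE])
  have N: "openin D (N d)" "d \<in> N d"
    and g: "continuous_map (subtopology P ({0..1} \<times> N d)) (top_of_set E) (g d)"
    and gl: "\<And>r x. r \<in> {0..1} \<Longrightarrow> x \<in> N d \<Longrightarrow> \<pi> (g d (r, x)) = f (r, x)"
    and g_0: "\<And>x. x \<in> N d \<Longrightarrow> g d (0, x) = g0 x" if "d \<in> topspace D" for d
    using bspec[OF R that] unfolding R_def by blast+
  have path: "continuous_map (top_of_set {0..1}) (top_of_set E) (\<lambda>r. g d (r, x))"
    if "d \<in> topspace D" "x \<in> N d" for d x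
  proof -
    have "x \<in> topspace D" using that N openin_subset by blast
    then have "continuous_map (top_of_set {0..1}) (subtopology P ({0..1} \<times> N d)) (\<lambda>r. (r, x))"
      unfolding P_def
      using that by (intro continuous_map_into_subtopology continuous_map_pairedI) auto
    from continuous_map_compose[OF this g] that show ?thesis by (simp add: o_def)
  qed
  have uniq: "g d (r, x) = g d' (r, x)"
    if "d \<in> topspace D" "d' \<in> topspace D" "x \<in> N d" "x \<in> N d'" "r \<in> {0..1}" for d d' r x
    by (rule lift_unique[of "{0..1}" "\<lambda>r. g d (r, x)" "\<lambda>r. g d' (r, x)" 0 r])
      (use that path gl g_0 in auto)
  show thesis
  proof
    show "continuous_map (prod_topology (top_of_set {0..1::real}) D) (top_of_set E) (\<lambda>(r, x). g x (r, x))"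
      unfolding P_def[symmetric]
    proof (rule pasting_lemma[where I = "topspace D" and T = "\<lambda>d. {0..1} \<times> N d" and f = g])
      show "openin P ({0..1} \<times> N d)" if "d \<in> topspace D" for d
        using N that by (auto simp: P_def openin_prod_Times_iff)
      show "g i x = g j x" if "i \<in> topspace D" "j \<in> topspace D"
        "x \<in> topspace P \<inter> {0..1} \<times> N i \<inter> {0..1} \<times> N j" for i j x
        using uniq[OF that(1,2), of "snd x" "fst x"] that(3) by (simp add: mem_Times_iff)
      show "\<exists>j. j \<in> topspace D \<and> x \<in> {0..1} \<times> N j \<and> (case x of (r, x) \<Rightarrow> g x (r, x)) = g j x"
        if "x \<in> topspace P" for x
        by (rule exI[of _ "snd x"]) (use that N(2) in \<open>auto simp: P_def\<close>)
    qed (rule g)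
    show "\<pi> (case (r, x) of (r, x) \<Rightarrow> g x (r, x)) = f (r, x)" if "r \<in> {0..1}" "x \<in> topspace D" for r x
      using gl[OF that(2,1)] N(2)[OF that(2)] by simp
    show "(case (0, x) of (r, x) \<Rightarrow> g x (r, x)) = g0 x" if "x \<in> topspace D" for x
      using g_0[OF that] N(2)[OF that] by simp
  qed
qed

end

section \<open>Cubes, spheroids and trivial homotopy groups\<close>

lemma topspace_cube: "topspace (cube k) = PiE {..<k} (\<lambda>_. {0..1})"
  by (simp add: cube_def)

lemma cube_boundary_subset: "cube_boundary k \<subseteq> topspace (cube k)"
  by (auto simp: cube_boundary_def)

lemma continuous_map_into_cube:
  assumes "\<And>i. i < k \<Longrightarrow> continuous_map X euclideanreal (\<lambda>x. f x i)"
    and "\<And>x. x \<in> topspace X \<Longrightarrow> f x \<in> topspace (cube k)"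
  shows "continuous_map X (cube k) f"
  unfolding cube_def continuous_map_componentwise
  using assms by (auto simp: topspace_cube PiE_iff continuous_map_in_subtopology)

lemma continuous_map_cube_coordinate:
  assumes "continuous_map X (cube k) f" "i < k"
  shows "continuous_map X euclideanreal (\<lambda>x. f x i)"
  using assms unfolding cube_def continuous_map_componentwise
  by (auto simp: continuous_map_in_subtopology)

lemma spheroid_concat_closed:
  assumes f: "f \<in> spheroids k X x" and g: "g \<in> spheroids k X x" and k: "0 < k"
  shows "spheroid_concat f g \<in> spheroids k X x"
proof -
  have fb: "f t = x" and gb: "g t = x" if "t \<in> cube_boundary k" for t
    using f g that by (auto simp: spheroids_def)
  have t0: "continuous_map (cube k) euclideanreal (\<lambda>t. t i)" if "i < k" for i
    using continuous_map_cube_coordinate[of "cube k" k id i] that by simp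
  have "continuous_map (cube k) X (\<lambda>t. if t 0 \<le> 1/2 then f (t(0 := 2 * t 0)) else g (t(0 := 2 * t 0 - 1)))"
  proof (rule continuous_map_cases_le)
    have "continuous_map (subtopology (cube k) {t \<in> topspace (cube k). t 0 \<le> 1/2}) (cube k) (\<lambda>t. t(0 := 2 * t 0))"
      by (rule continuous_map_into_cube)
        (use k t0 in \<open>auto simp: topspace_cube PiE_iff extensional_def fun_upd_def
            intro!: continuous_map_from_subtopology continuous_intros\<close>)
    from continuous_map_compose[OF this, of X f] f
    show "continuous_map (subtopology (cube k) {t \<in> topspace (cube k). t 0 \<le> 1/2}) X (\<lambda>t. f (t(0 := 2 * t 0)))"
      by (simp add: spheroids_def o_def)
    have "continuous_map (subtopology (cube k) {t \<in> topspace (cube k). 1/2 \<le> t 0}) (cube k) (\<lambda>t. t(0 := 2 * t 0 - 1))"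
      by (rule continuous_map_into_cube)
        (use k t0 in \<open>auto simp: topspace_cube PiE_iff extensional_def fun_upd_def
            intro!: continuous_map_from_subtopology continuous_intros\<close>)
    from continuous_map_compose[OF this, of X g] g
    show "continuous_map (subtopology (cube k) {t \<in> topspace (cube k). 1/2 \<le> t 0}) X (\<lambda>t. g (t(0 := 2 * t 0 - 1)))"
      by (simp add: spheroids_def o_def)
    show "f (t(0 := 2 * t 0)) = g (t(0 := 2 * t 0 - 1))" if "t \<in> topspace (cube k)" "t 0 = 1/2" for t
    proof -
      have "t(0 := 2 * t 0) \<in> cube_boundary k" "t(0 := 2 * t 0 - 1) \<in> cube_boundary k"
        using that k by (auto simp: cube_boundary_def topspace_cube PiE_iff extensional_def)
      then show ?thesis using fb gb by simp
    qed
  qed (use k t0 in auto)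
  then have "continuous_map (cube k) X (spheroid_concat f g)"
    by (simp add: spheroid_concat_def[abs_def])
  moreover have "spheroid_concat f g t = x" if t: "t \<in> cube_boundary k" for t
  proof -
    obtain i where i: "i < k" "t i = 0 \<or> t i = 1" and tc: "t \<in> topspace (cube k)"
      using t by (auto simp: cube_boundary_def)
    have t01: "0 \<le> t 0" "t 0 \<le> 1" using tc k by (auto simp: topspace_cube PiE_iff)
    show ?thesis
    proof (cases "t 0 \<le> 1/2")
      case True
      have "t(0 := 2 * t 0) \<in> cube_boundary k"
        using True t01 i tc k unfolding cube_boundary_def topspace_cube
        by (cases "i = 0") (auto simp: PiE_iff extensional_def intro!: exI[of _ i])
      then show ?thesis using True fb by (simp add: spheroid_concat_def)
    next
      case False
      have "t(0 := 2 * t 0 - 1) \<in> cube_boundary k"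
        using False t01 i tc k unfolding cube_boundary_def topspace_cube
        by (cases "i = 0") (auto simp: PiE_iff extensional_def intro!: exI[of _ i])
      then show ?thesis using False gb by (simp add: spheroid_concat_def)
    qed
  qed
  ultimately show ?thesis by (simp add: spheroids_def)
qed

text \<open>With a single class the group axioms are immediate, once the union defining the product
  is seen to be that class; this holds because concatenations are again spheroids.\<close>

lemma trivial_homotopy_group:
  assumes x: "x \<in> topspace X" and k: "0 < k"
    and null: "\<And>f. f \<in> spheroids k X x \<Longrightarrow> (f, \<lambda>_. x) \<in> spheroid_homotopy k X x"
  shows "trivial_group (homotopy_group k X x)"
proof -
  define c where "c = spheroid_homotopy k X x `` {\<lambda>_. x}"
  have const: "(\<lambda>_. x) \<in> spheroids k X x" using x by (simp add: spheroids_def)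
  have cls: "spheroid_homotopy k X x `` {f} = c" if "f \<in> spheroids k X x" for f
    using null[OF that] unfolding c_def spheroid_homotopy_def
    by (auto intro: homotopic_with_trans homotopic_with_symD)
  have c_sub: "c \<subseteq> spheroids k X x"
    unfolding c_def spheroid_homotopy_def spheroids_def
    by (auto dest: homotopic_with_imp_continuous_maps homotopic_with_imp_property)
  have c_ne: "(\<lambda>_. x) \<in> c" using null[OF const] by (simp add: c_def)
  have carrier: "carrier (homotopy_group k X x) = {c}"
    using cls const by (auto simp: homotopy_group_def quotient_def)
  have one: "\<one>\<^bsub>homotopy_group k X x\<^esub> = c" by (simp add: homotopy_group_def c_def)
  have "spheroid_homotopy k X x `` {spheroid_concat f g} = c" if "f \<in> c" "g \<in> c" for f g
    by (intro cls spheroid_concat_closed k subsetD[OF c_sub] that)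
  then have mult: "c \<otimes>\<^bsub>homotopy_group k X x\<^esub> c = c"
    using c_ne by (auto simp: homotopy_group_def)
  have "group (homotopy_group k X x)"
    by (rule groupI) (auto simp: carrier one mult)
  then show ?thesis by (simp add: trivial_group_def carrier one)
qed

context sheeted
begin

lemma lift_constant_path:
  assumes "continuous_map (top_of_set {0..1::real}) (top_of_set E) g"
    and "\<And>s. s \<in> {0..1} \<Longrightarrow> \<pi> (g s) = \<pi> (g 0)" and "s \<in> {0..1}"
  shows "g s = g 0"
proof (rule lift_unique[OF connected_Icc assms(1), of "\<lambda>_. g 0" 0 s])
  have "g 0 \<in> E" using continuous_map_funspace[OF assms(1)] by (auto simp: Pi_iff)
  then show "continuous_map (top_of_set {0..1}) (top_of_set E) (\<lambda>_. g 0)" by simp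
  show "\<pi> (g r) = \<pi> (g 0)" if "r \<in> {0..1}" for r using assms(2)[OF that] .
qed (use assms(3) in simp_all)

text \<open>Scaling contracts the cube to the corner 0, a boundary point, so \<open>f\<close> is
  lifted radially starting from \<open>e\<close>. On a face through that corner the radial path
  stays in the boundary, so its lift is constant. The opposite faces need a second path.\<close>

lemma spheroid_lift:
  assumes f: "f \<in> spheroids k B (\<pi> e)" and k: "2 \<le> k" and e: "e \<in> E"
  obtains g where "continuous_map (cube k) (top_of_set E) g"
    "\<And>t. t \<in> topspace (cube k) \<Longrightarrow> \<pi> (g t) = f t" "\<And>t. t \<in> cube_boundary k \<Longrightarrow> g t = e"
proof -
  define sc where "sc = (\<lambda>(s::real, t::nat \<Rightarrow> real). \<lambda>i\<in>{..<k}. s * t i)"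
  define P where "P = prod_topology (top_of_set {0..1::real}) (cube k)"
  have cf: "continuous_map (cube k) B f" and fb: "\<And>t. t \<in> cube_boundary k \<Longrightarrow> f t = \<pi> e"
    using f by (auto simp: spheroids_def)
  have coord: "continuous_map (cube k) euclideanreal (\<lambda>t. t i)" if "i < k" for i
    using continuous_map_cube_coordinate[of "cube k" k id i] that by simp
  have sc_cube: "sc (s, t) \<in> topspace (cube k)" if "s \<in> {0..1}" "t \<in> topspace (cube k)" for s t
    using that by (auto simp: sc_def topspace_cube PiE_iff mult_le_one)
  have sc: "continuous_map P (cube k) sc"
  proof (rule continuous_map_into_cube)
    fix i assume i: "i < k"
    have "continuous_map P (top_of_set {0..1}) fst" "continuous_map P (cube k) snd"
      unfolding P_def by (rule continuous_map_fst continuous_map_snd)+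
    then have "continuous_map P euclideanreal (\<lambda>z. fst z * snd z i)"
      using continuous_map_compose[OF _ coord[OF i]]
      by (intro continuous_map_real_mult) (auto simp: o_def continuous_map_in_subtopology)
    then show "continuous_map P euclideanreal (\<lambda>z. sc z i)"
      using i by (simp add: sc_def case_prod_unfold)
  qed (use sc_cube in \<open>auto simp: P_def\<close>)
  have sc0: "sc (s, t) \<in> cube_boundary k" if "s \<in> {0..1}" "t \<in> topspace (cube k)" "j < k" "s * t j = 0" for s t j
    using sc_cube[OF that(1,2)] that(3,4) unfolding cube_boundary_def by (auto simp: sc_def intro!: exI[of _ j])
  obtain G where G: "continuous_map P (top_of_set E) G"
    and Gl: "\<And>s t. s \<in> {0..1} \<Longrightarrow> t \<in> topspace (cube k) \<Longrightarrow> \<pi> (G (s, t)) = (f \<circ> sc) (s, t)"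
    and G0: "\<And>t. t \<in> topspace (cube k) \<Longrightarrow> G (0, t) = e"
  proof (rule homotopy_lifting)
    show "continuous_map (prod_topology (top_of_set {0..1}) (cube k)) B (f \<circ> sc)"
      using continuous_map_compose[OF sc cf] by (simp add: P_def)
    show "continuous_map (cube k) (top_of_set E) (\<lambda>_. e)" using e by simp
    show "(f \<circ> sc) (0, t) = \<pi> e" if "t \<in> topspace (cube k)" for t
      using fb[OF sc0[of 0 t 0]] that k by simp
  qed (auto simp: P_def)
  define g where "g t = G (1, t)" for t
  have cg: "continuous_map (cube k) (top_of_set E) g"
  proof -
    have "continuous_map (cube k) P (\<lambda>t. (1, t))"
      unfolding P_def by (intro continuous_map_pairedI) auto
    from continuous_map_compose[OF this G] show ?thesis by (simp add: g_def[abs_def] o_def)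
  qed
  have gl: "\<pi> (g t) = f t" if "t \<in> topspace (cube k)" for t
  proof -
    have "sc (1, t) = t" using that by (auto simp: sc_def topspace_cube)
    then show ?thesis using Gl[of 1 t] that by (simp add: g_def)
  qed
  have face0: "g t = e" if t: "t \<in> topspace (cube k)" "j < k" "t j = 0" for t j
  proof -
    have "continuous_map (top_of_set {0..1}) P (\<lambda>s. (s, t))"
      unfolding P_def using t by (intro continuous_map_pairedI) auto
    from continuous_map_compose[OF this G]
    have c: "continuous_map (top_of_set {0..1}) (top_of_set E) (\<lambda>s. G (s, t))" by (simp add: o_def)
    have "G (1, t) = G (0, t)"
    proof (rule lift_constant_path[OF c])
      show "\<pi> (G (s, t)) = \<pi> (G (0, t))" if "s \<in> {0..1}" for s
        using that t Gl[of s t] fb[OF sc0[of s t j]] G0[of t] by simp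
    qed auto
    then show ?thesis using G0 t by (simp add: g_def)
  qed
  have "g t = e" if t: "t \<in> cube_boundary k" for t
  proof -
    obtain i where i: "i < k" "t i = 0 \<or> t i = 1" and tc: "t \<in> topspace (cube k)"
      using t by (auto simp: cube_boundary_def)
    \<comment> \<open>Here the dimension is at least 2: a point of the face \<open>t i = 1\<close>
      can be moved inside the boundary to a face \<open>t j = 0\<close> with
      \<open>j \<noteq> i\<close>. In dimension 1 the lift of a loop may end at another point of the
      fibre.\<close>
    obtain j where j: "j < k" "j \<noteq> i"
      using k i by (cases "i = 0") (auto intro: that[of 1] that[of 0])
    define p where "p s = t(j := s * t j)" for s
    have pb: "p s \<in> cube_boundary k" if "s \<in> {0..1}" for s
      using that i j tc unfolding cube_boundary_def topspace_cube p_def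
      by (auto simp: PiE_iff extensional_def mult_le_one intro!: exI[of _ i])
    have "continuous_map (top_of_set {0..1}) (cube k) p"
      by (rule continuous_map_into_cube) (use pb cube_boundary_subset in
          \<open>auto simp: p_def fun_upd_def intro!: continuous_intros\<close>)
    from continuous_map_compose[OF this cg]
    have c: "continuous_map (top_of_set {0..1}) (top_of_set E) (\<lambda>s. g (p s))" by (simp add: o_def)
    have "g (p 1) = g (p 0)"
    proof (rule lift_constant_path[OF c])
      show "\<pi> (g (p s)) = \<pi> (g (p 0))" if "s \<in> {0..1}" for s
        using gl[of "p s"] gl[of "p 0"] fb[OF pb[OF that]] fb[OF pb[of 0]] pb that cube_boundary_subset
        by (metis atLeastAtMost_iff order_refl subsetD zero_le_one)
    qed auto
    also have "g (p 0) = e"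
      using face0[of "p 0" j] pb[of 0] cube_boundary_subset j by (auto simp: p_def)
    finally show ?thesis by (simp add: p_def)
  qed
  then show thesis using that cg gl by blast
qed

text \<open>The hypothesis contracts the projection and not \<open>E\<close> itself, so the homotopy
  may take values that come from outside \<open>E\<close>. It fixes the base point throughout, as
  the homotopy of spheroids must.\<close>

theorem aspherical:
  assumes surj: "\<pi> ` E = topspace B" and q: "q \<in> topspace B"
    and contraction: "\<And>e. e \<in> E \<Longrightarrow> \<exists>K. continuous_map (prod_topology (top_of_set {0..1::real}) (top_of_set E)) B K \<and>
      (\<forall>x\<in>E. K (0, x) = \<pi> x \<and> K (1, x) = \<pi> e) \<and> (\<forall>s\<in>{0..1}. K (s, e) = \<pi> e)"
  shows "eilenberg_maclane B q (homotopy_group 1 B q) 1"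
  unfolding eilenberg_maclane_def
proof (intro conjI allI impI)
  show "path_connected_space B"
    unfolding path_connected_space_def
  proof (intro ballI)
    fix x y assume "x \<in> topspace B" "y \<in> topspace B"
    then obtain d e where de: "d \<in> E" "\<pi> d = x" "e \<in> E" "\<pi> e = y" using surj by (metis imageE)
    obtain K where K: "continuous_map (prod_topology (top_of_set {0..1::real}) (top_of_set E)) B K"
      and K01: "\<forall>x\<in>E. K (0, x) = \<pi> x \<and> K (1, x) = \<pi> e" using contraction[OF de(3)] by blast
    have "continuous_map (top_of_set {0..1}) (prod_topology (top_of_set {0..1::real}) (top_of_set E)) (\<lambda>s. (s, d))"
      using de by (intro continuous_map_pairedI) auto
    from continuous_map_compose[OF this K] have "pathin B (\<lambda>s. K (s, d))"
      by (simp add: pathin_def o_def)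
    then show "\<exists>g. pathin B g \<and> g 0 = x \<and> g 1 = y" using K01 de by blast
  qed
  fix k :: nat assume "1 \<le> k" "k \<noteq> 1"
  then have k: "2 \<le> k" "0 < k" by auto
  show "trivial_group (homotopy_group k B q)"
  proof (rule trivial_homotopy_group[OF q k(2)])
    fix f assume f: "f \<in> spheroids k B q"
    obtain e where e: "e \<in> E" "\<pi> e = q" using surj q by (metis imageE)
    obtain g where g: "continuous_map (cube k) (top_of_set E) g"
      and gl: "\<And>t. t \<in> topspace (cube k) \<Longrightarrow> \<pi> (g t) = f t"
      and gb: "\<And>t. t \<in> cube_boundary k \<Longrightarrow> g t = e"
      using spheroid_lift[of f k e] f e k by auto
    obtain K where K: "continuous_map (prod_topology (top_of_set {0..1::real}) (top_of_set E)) B K"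
      and K01: "\<forall>x\<in>E. K (0, x) = \<pi> x \<and> K (1, x) = \<pi> e" and Ke: "\<forall>s\<in>{0..1}. K (s, e) = \<pi> e"
      using contraction[OF e(1)] by blast
    have gE: "g t \<in> E" if "t \<in> topspace (cube k)" for t
      using continuous_map_funspace[OF g] that by auto
    have "continuous_map (prod_topology (top_of_set {0..1::real}) (cube k))
      (prod_topology (top_of_set {0..1::real}) (top_of_set E)) (\<lambda>z. (fst z, g (snd z)))"
      using continuous_map_compose[OF continuous_map_snd g]
      by (intro continuous_map_pairedI continuous_map_fst) (auto simp: o_def)
    from continuous_map_compose[OF this K]
    have c: "continuous_map (prod_topology (top_of_set {0..1::real}) (cube k)) B (\<lambda>z. K (fst z, g (snd z)))"
      by (simp add: o_def)
    show "(f, \<lambda>_. q) \<in> spheroid_homotopy k B q"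
      unfolding spheroid_homotopy_def mem_Collect_eq prod.case
    proof (subst homotopic_with)
      show "(\<forall>t\<in>cube_boundary k. h t = q) = (\<forall>t\<in>cube_boundary k. h' t = q)"
        if "\<And>x. x \<in> topspace (cube k) \<Longrightarrow> h x = h' x" for h h'
        by (intro ball_cong refl) (metis cube_boundary_subset subsetD that)
      show "\<exists>h. continuous_map (prod_topology (top_of_set {0..1::real}) (cube k)) B h \<and>
          (\<forall>x\<in>topspace (cube k). h (0, x) = f x) \<and> (\<forall>x\<in>topspace (cube k). h (1, x) = q) \<and>
          (\<forall>t\<in>{0..1}. \<forall>ta\<in>cube_boundary k. h (t, ta) = q)"
      proof (rule exI[where x = "\<lambda>z. K (fst z, g (snd z))"], intro conjI ballI)
        show "K (fst (0, t), g (snd (0, t))) = f t" "K (fst (1, t), g (snd (1, t))) = q"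
          if "t \<in> topspace (cube k)" for t
          using K01 gE[OF that] gl[OF that] e by auto
        show "K (fst (s, t), g (snd (s, t))) = q" if "s \<in> {0..1}" "t \<in> cube_boundary k" for s t
          using Ke gb[OF that(2)] that(1) e by auto
      qed (rule c)
    qed
  qed
qed (use q in auto)

end

section \<open>Right-angled reflection groups\<close>

text \<open>The Tits form has 1 on the diagonal and \<open>- m s t\<close> off it. Weight 0 stands
  for commuting generators, and a weight of at least 1 makes their product have infinite
  order.\<close>

locale weighted_graph =
  fixes S :: "'i set" and m :: "'i \<Rightarrow> 'i \<Rightarrow> real"
  assumes fin: "finite S" and sym: "m s t = m t s" and irr: "m s s = 0"
    and weight: "m s t = 0 \<or> 1 \<le> m s t" and supp: "m s t \<noteq> 0 \<Longrightarrow> s \<in> S"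
begin

text \<open>\<open>refl 2\<close> is the Tits representation of the group, in coordinates dual to the simple roots.\<close>

definition refl :: "real \<Rightarrow> 'i \<Rightarrow> ('i \<Rightarrow> real) \<Rightarrow> 'i \<Rightarrow> real" where
  "refl c s v t = (if t = s then - v s else v t + c * m s t * v s)"

lemma refl_refl [simp]: "refl c s (refl c s v) = v"
  by (auto simp: refl_def fun_eq_iff)

lemma refl_commute: "m s t = 0 \<Longrightarrow> refl c s (refl c t v) = refl c t (refl c s v)"
  using sym[of s t] by (auto simp: refl_def fun_eq_iff algebra_simps)

lemma weight_nonneg: "0 \<le> m s t"
  using weight[of s t] by auto

lemma supp2: "m s t \<noteq> 0 \<Longrightarrow> t \<in> S"
  using supp[of t s] sym by simp

lemma fold_refl_rev: "fold (refl c) (rev w) (fold (refl c) w v) = v"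
  by (induction w arbitrary: v) auto

section \<open>Positive roots\<close>

definition nb :: "('i \<Rightarrow> real) \<Rightarrow> 'i \<Rightarrow> real" where
  "nb k s = (\<Sum>t\<in>S. m s t * k t)"

text \<open>For the vector \<open>k\<close> of coefficients in the simple roots,
  \<open>k s - nb k s\<close> is the Tits form of \<open>k\<close> with the simple root at
  \<open>s\<close>; subtracting twice this at \<open>s\<close> is the usual reflection.\<close>

definition coroot_refl :: "'i \<Rightarrow> ('i \<Rightarrow> real) \<Rightarrow> 'i \<Rightarrow> real" where
  "coroot_refl s k = k(s := 2 * nb k s - k s)"

definition simple :: "'i \<Rightarrow> 'i \<Rightarrow> real" where
  "simple s = (\<lambda>t. if t = s then 1 else 0)"

inductive_set roots :: "('i \<Rightarrow> real) set" where
  simple: "s \<in> S \<Longrightarrow> simple s \<in> roots"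
| up: "k \<in> roots \<Longrightarrow> s \<in> S \<Longrightarrow> k s < nb k s \<Longrightarrow> coroot_refl s k \<in> roots"

lemma nb_upd: "s \<in> S \<Longrightarrow> nb (k(s := x)) t = nb k t + m t s * (x - k s)"
  unfolding nb_def using fin by (simp add: sum.remove[of S s] algebra_simps)

lemma nb_coroot_refl_self [simp]: "s \<in> S \<Longrightarrow> nb (coroot_refl s k) s = nb k s"
  by (simp add: coroot_refl_def nb_upd irr)

lemma nb_coroot_refl_other: "s \<in> S \<Longrightarrow> m s t = 0 \<Longrightarrow> nb (coroot_refl s k) t = nb k t"
  using sym[of s t] by (simp add: coroot_refl_def nb_upd)

lemma coroot_refl_refl [simp]: "s \<in> S \<Longrightarrow> coroot_refl s (coroot_refl s k) = k"
  using nb_coroot_refl_self[of s k] by (auto simp: coroot_refl_def fun_eq_iff)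

lemma coroot_refl_commute:
  "s \<in> S \<Longrightarrow> t \<in> S \<Longrightarrow> s \<noteq> t \<Longrightarrow> m s t = 0 \<Longrightarrow> coroot_refl s (coroot_refl t k) = coroot_refl t (coroot_refl s k)"
  using sym[of s t] by (auto simp: coroot_refl_def fun_eq_iff nb_upd)

lemma nb_simple: "s \<in> S \<Longrightarrow> nb (simple s) t = m t s"
proof -
  assume "s \<in> S"
  moreover have "nb (simple s) t = (\<Sum>u\<in>S. if u = s then m t s else 0)"
    unfolding nb_def by (intro sum.cong) (auto simp: simple_def)
  ultimately show "nb (simple s) t = m t s" using fin by simp
qed

lemma nb_nonneg: "(\<And>t. 0 \<le> k t) \<Longrightarrow> 0 \<le> nb k s"
  unfolding nb_def by (intro sum_nonneg mult_nonneg_nonneg weight_nonneg)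

lemma nb_ge: "(\<And>t. 0 \<le> k t) \<Longrightarrow> m s t \<noteq> 0 \<Longrightarrow> k t \<le> nb k s"
proof -
  assume k: "\<And>t. 0 \<le> k t" and st: "m s t \<noteq> 0"
  have "k t \<le> m s t * k t" using mult_right_mono[of 1 "m s t" "k t"] weight[of s t] st k by auto
  also have "\<dots> \<le> nb k s"
    unfolding nb_def by (rule member_le_sum) (use supp2[OF st] fin k weight_nonneg in auto)
  finally show ?thesis .
qed

lemma roots_nonneg: "k \<in> roots \<Longrightarrow> 0 \<le> k t"
proof (induction arbitrary: t rule: roots.induct)
  case (up k s)
  then show ?case using nb_nonneg[of k s] by (auto simp: coroot_refl_def)
qed (simp add: simple_def)

text \<open>An ascent at \<open>s\<close> needs a neighbour of \<open>s\<close> with positive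
  coefficient; it keeps that coefficient and makes the one at \<open>s\<close> positive. Since two
  adjacent coordinates of a chamber vector never vanish together, such roots are positive on the
  chamber.\<close>

lemma roots_support:
  "k \<in> roots \<Longrightarrow> (\<exists>s\<in>S. k = simple s) \<or> (\<exists>s t. m s t \<noteq> 0 \<and> 0 < k s \<and> 0 < k t)"
proof (induction rule: roots.induct)
  case (up k s)
  have k0: "0 \<le> k t" for t using roots_nonneg up by blast
  have "0 < nb k s" by (rule le_less_trans[OF k0 up.hyps(3)])
  have "\<exists>t\<in>S. m s t * k t \<noteq> 0"
  proof (rule ccontr)
    assume "\<not> ?thesis"
    then have "nb k s = 0" unfolding nb_def by (intro sum.neutral) blast
    then show False using \<open>0 < nb k s\<close> by simp
  qed
  then obtain t where t: "m s t \<noteq> 0" "k t \<noteq> 0" by auto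
  then have "t \<noteq> s" using irr by auto
  then have "0 < coroot_refl s k t" using k0[of t] t by (simp add: coroot_refl_def)
  moreover have "0 < coroot_refl s k s" using up.hyps \<open>0 < nb k s\<close> by (simp add: coroot_refl_def)
  ultimately show ?case using t by blast
qed auto

text \<open>
  Tits' theorem for this reflection group. The only case in which a root might leave the positive
  ones is a descent at \<open>s\<close> right after an ascent at a neighbour \<open>u\<close> of \<open>s\<close>; as all weights
  are at least 1, this would force both \<open>k s > k u\<close> and \<open>k u > k s\<close>.
\<close>

lemma roots_refl_closed:
  "k \<in> roots \<Longrightarrow> s \<in> S \<Longrightarrow> k \<noteq> simple s \<Longrightarrow> coroot_refl s k \<in> roots"
proof (induction rule: roots.induct)
  case (simple u)
  have "simple u s = 0" using simple.prems by (auto simp: simple_def)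
  moreover have "0 \<le> nb (simple u) s" by (rule nb_nonneg) (simp add: simple_def)
  moreover have "coroot_refl s (simple u) = simple u" if "nb (simple u) s = 0"
    using that \<open>simple u s = 0\<close> by (auto simp: coroot_refl_def fun_eq_iff)
  ultimately show ?case
    using roots.up[OF roots.simple[OF simple.hyps] simple.prems(1)] roots.simple[OF simple.hyps]
    by (cases "nb (simple u) s = 0") auto
next
  case (up k u)
  let ?k = "coroot_refl u k"
  have root: "?k \<in> roots" using up.hyps by (rule roots.up)
  have pos: "0 \<le> ?k t" for t using roots_nonneg[OF root] .
  consider "s = u" | "s \<noteq> u" "m s u = 0" | "s \<noteq> u" "m s u \<noteq> 0" by blast
  then show ?case
  proof cases
    case 1
    then show ?thesis using up.hyps by simp
  next
    case 2
    have mus: "m u s = 0" using 2 sym by metis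
    have "k \<noteq> simple s"
      using up.hyps(3) nb_simple[OF up.prems(1), of u] mus by (auto simp: simple_def split: if_splits)
    then have IH: "coroot_refl s k \<in> roots" using up.IH up.prems by blast
    have "coroot_refl s k u < nb (coroot_refl s k) u"
      using nb_coroot_refl_other[of s u k] up.hyps(3) up.prems 2 by (simp add: coroot_refl_def)
    then have "coroot_refl u (coroot_refl s k) \<in> roots" using roots.up[OF IH up.hyps(2)] by blast
    then show ?thesis using coroot_refl_commute[of s u k] 2 up by simp
  next
    case 3
    have "?k u > nb ?k u" using up.hyps by (simp add: coroot_refl_def[of u k]) (simp add: coroot_refl_def[symmetric])
    moreover have "?k s \<le> nb ?k u" using nb_ge[of ?k u s] pos 3 sym by metis
    moreover have "?k u \<le> nb ?k s" using nb_ge[of ?k s u] pos 3 by blast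
    ultimately have "?k s < nb ?k s" by linarith
    then show ?thesis using roots.up[OF root up.prems(1)] by blast
  qed
qed

section \<open>The Tits cone and its chamber\<close>

definition pair :: "('i \<Rightarrow> real) \<Rightarrow> ('i \<Rightarrow> real) \<Rightarrow> real" where
  "pair k v = (\<Sum>i\<in>S. k i * v i)"

lemma pair_simple: "s \<in> S \<Longrightarrow> pair (simple s) v = v s"
proof -
  assume "s \<in> S"
  moreover have "pair (simple s) v = (\<Sum>u\<in>S. if u = s then v s else 0)"
    unfolding pair_def by (intro sum.cong) (auto simp: simple_def)
  ultimately show "pair (simple s) v = v s" using fin by simp
qed

lemma pair_refl:
  assumes s: "s \<in> S" shows "pair k (refl 2 s v) = pair (coroot_refl s k) v"
proof -
  have "pair k (refl 2 s v) = k s * (- v s) + (\<Sum>i\<in>S - {s}. k i * (v i + 2 * m s i * v s))"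
    unfolding pair_def using fin s by (subst sum.remove[of S s]) (auto simp: refl_def)
  also have "(\<Sum>i\<in>S - {s}. k i * (v i + 2 * m s i * v s))
      = (\<Sum>i\<in>S - {s}. k i * v i) + 2 * v s * (\<Sum>i\<in>S - {s}. m s i * k i)"
    by (simp add: sum.distrib sum_distrib_left algebra_simps)
  also have "(\<Sum>i\<in>S - {s}. m s i * k i) = nb k s"
    unfolding nb_def using fin s by (simp add: sum.remove[of S s] irr)
  finally have "pair k (refl 2 s v) = (2 * nb k s - k s) * v s + (\<Sum>i\<in>S - {s}. k i * v i)"
    by (simp add: algebra_simps)
  also have "\<dots> = pair (coroot_refl s k) v"
    unfolding pair_def sum.remove[OF fin s, of "\<lambda>i. coroot_refl s k i * v i"] by (simp add: coroot_refl_def)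
  finally show ?thesis .
qed

text \<open>The interior of the Tits cone.\<close>

definition cone :: "('i \<Rightarrow> real) set" where
  "cone = {v. (\<forall>i. i \<notin> S \<longrightarrow> v i = 0) \<and> finite {k \<in> roots. pair k v \<le> 0}}"

text \<open>The closed chamber without the faces whose stabilizers are infinite. In terms of
  configurations, the omitted faces are the triple collisions.\<close>

definition chamber :: "('i \<Rightarrow> real) set" where
  "chamber = {v. (\<forall>i. i \<notin> S \<longrightarrow> v i = 0) \<and> (\<forall>i\<in>S. 0 \<le> v i) \<and> (\<forall>s t. m s t \<noteq> 0 \<longrightarrow> 0 < v s \<or> 0 < v t)}"

text \<open>A convex combination pairs nonpositively with a root only if one of its ends does.
  Defining the cone by its roots makes convexity this easy; the price is to show that the translates
  of the chamber fill it.\<close>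

lemma cone_convex:
  assumes "u \<in> cone" "v \<in> cone" "0 \<le> a" "a \<le> 1"
  shows "(\<lambda>i. (1 - a) * u i + a * v i) \<in> cone"
proof -
  let ?w = "\<lambda>i. (1 - a) * u i + a * v i"
  have "pair k ?w = (1 - a) * pair k u + a * pair k v" for k
    unfolding pair_def sum_distrib_left sum.distrib[symmetric] by (intro sum.cong) (auto simp: algebra_simps)
  moreover have "0 < (1 - a) * x + a * y" if "0 < x" "0 < y" for x y :: real
    using that assms(3,4) by (cases "a = 0") (auto intro: add_nonneg_pos)
  ultimately have "{k \<in> roots. pair k ?w \<le> 0} \<subseteq> {k \<in> roots. pair k u \<le> 0} \<union> {k \<in> roots. pair k v \<le> 0}"
    by (auto simp: not_le[symmetric])
  then have "finite {k \<in> roots. pair k ?w \<le> 0}"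
    by (rule finite_subset) (use assms(1,2) in \<open>auto simp: cone_def\<close>)
  then show ?thesis using assms by (auto simp: cone_def)
qed

lemma refl_outside: "s \<in> S \<Longrightarrow> (\<And>i. i \<notin> S \<Longrightarrow> v i = 0) \<Longrightarrow> i \<notin> S \<Longrightarrow> refl c s v i = 0"
  using supp2[of s i] by (auto simp: refl_def)

text \<open>The reflection at \<open>s\<close> maps every positive root except
  \<open>simple s\<close> to a positive root, so the set of nonpositive ones grows by at most this
  root.\<close>

lemma cone_refl:
  assumes v: "v \<in> cone" and s: "s \<in> S"
  shows "refl 2 s v \<in> cone"
proof -
  have "{k \<in> roots. pair k (refl 2 s v) \<le> 0} \<subseteq> insert (simple s) (coroot_refl s ` {k \<in> roots. pair k v \<le> 0})"
  proof
    fix k assume k: "k \<in> {k \<in> roots. pair k (refl 2 s v) \<le> 0}"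
    show "k \<in> insert (simple s) (coroot_refl s ` {k \<in> roots. pair k v \<le> 0})"
    proof (cases "k = simple s")
      case False
      then have "coroot_refl s k \<in> {k \<in> roots. pair k v \<le> 0}"
        using k roots_refl_closed s by (auto simp: pair_refl)
      then have "coroot_refl s (coroot_refl s k) \<in> coroot_refl s ` {k \<in> roots. pair k v \<le> 0}" by (rule imageI)
      then show ?thesis using s by simp
    qed auto
  qed
  then have "finite {k \<in> roots. pair k (refl 2 s v) \<le> 0}"
    by (rule finite_subset) (use v in \<open>simp add: cone_def\<close>)
  then show ?thesis using v refl_outside[OF s, of v] by (auto simp: cone_def)
qed

text \<open>Reflecting at the smaller of the two coefficients makes it the larger one, as the weight
  is at least 1. The two stay distinct and their sum strictly increases, so no root in
  \<open>F\<close> has maximal sum.\<close>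

lemma dihedral_roots_infinite:
  assumes st: "m s t \<noteq> 0"
  shows "infinite {k \<in> roots. \<forall>i. i \<notin> {s, t} \<longrightarrow> k i = 0}"
proof
  assume fin': "finite {k \<in> roots. \<forall>i. i \<notin> {s, t} \<longrightarrow> k i = 0}"
  define F where "F = {k \<in> roots. (\<forall>i. i \<notin> {s, t} \<longrightarrow> k i = 0) \<and> k s \<noteq> k t}"
  have S: "s \<in> S" "t \<in> S" and ne: "s \<noteq> t" using supp supp2 st irr by auto
  have grow: "\<exists>k'\<in>F. k x + k y < k' x + k' y"
    if "k \<in> F" "k x < k y" "{x, y} = {s, t}" for k x y
  proof -
    have xy: "x \<in> S" "y \<in> S" "x \<noteq> y" "m x y \<noteq> 0" using that S ne st sym by (auto simp: doubleton_eq_iff)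
    have k: "k \<in> roots" "\<forall>i. i \<notin> {x, y} \<longrightarrow> k i = 0" using that by (auto simp: F_def)
    have "nb k x = (\<Sum>i\<in>{x, y}. m x i * k i)"
      unfolding nb_def using xy k(2) fin by (intro sum.mono_neutral_right) auto
    then have nb: "nb k x = m x y * k y" using xy irr by simp
    have "k y \<le> m x y * k y"
      using mult_right_mono[of 1 "m x y" "k y"] weight[of x y] xy roots_nonneg[OF k(1), of y] by auto
    then have lt: "k x < nb k x" "k y \<le> nb k x" using that(2) nb by auto
    have "coroot_refl x k \<in> roots" using k xy lt by (intro roots.up)
    then have "coroot_refl x k \<in> F"
      using lt k(2) that(3) xy unfolding F_def
      by (auto simp: coroot_refl_def doubleton_eq_iff)
    then show ?thesis using lt xy by (intro bexI[of _ "coroot_refl x k"]) (auto simp: coroot_refl_def)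
  qed
  have finF: "finite F" by (rule finite_subset[OF _ fin']) (auto simp: F_def)
  have "simple s \<in> F" using S ne by (auto simp: F_def roots.simple) (auto simp: simple_def)
  then have "F \<noteq> {}" by auto
  have img: "finite ((\<lambda>k. k s + k t) ` F)" "(\<lambda>k. k s + k t) ` F \<noteq> {}" using finF \<open>F \<noteq> {}\<close> by auto
  obtain K where "K \<in> F" "K s + K t = Max ((\<lambda>k. k s + k t) ` F)"
    using Max_in[OF img] by (metis (no_types, lifting) imageE)
  then have K: "K \<in> F" "\<And>k. k \<in> F \<Longrightarrow> k s + k t \<le> K s + K t"
    using Max_ge[OF img(1)] by auto
  have "K s \<noteq> K t" using K(1) by (simp add: F_def)
  then consider "K s < K t" | "K t < K s" by linarith
  then show False
  proof cases
    case 1 then show False using grow[of K s t] K by force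
  next
    case 2 then show False using grow[of K t s] K by force
  qed
qed

text \<open>Otherwise \<open>v\<close> would pair nonpositively with the infinitely many roots
  supported on \<open>{s, t}\<close>. This is how the absence of triple collisions enters: negative
  coordinates of a vector in the cone belong to commuting reflections.\<close>

lemma cone_adjacent:
  assumes v: "v \<in> cone" and st: "m s t \<noteq> 0"
  shows "0 < v s \<or> 0 < v t"
proof (rule ccontr)
  assume neg: "\<not> (0 < v s \<or> 0 < v t)"
  have "pair k v \<le> 0" if k: "k \<in> roots" "\<forall>i. i \<notin> {s, t} \<longrightarrow> k i = 0" for k
    unfolding pair_def
  proof (rule sum_nonpos)
    show "k i * v i \<le> 0" for i
      using k(2) roots_nonneg[OF k(1), of i] neg by (cases "i \<in> {s, t}") (auto simp: mult_nonneg_nonpos)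
  qed
  then have "{k \<in> roots. \<forall>i. i \<notin> {s, t} \<longrightarrow> k i = 0} \<subseteq> {k \<in> roots. pair k v \<le> 0}" by auto
  then show False using v dihedral_roots_infinite[OF st] by (auto simp: cone_def dest: finite_subset)
qed

text \<open>A root pairing nonpositively with a chamber vector has only zero terms in the pairing,
  so its support contains no adjacent pair and \<open>roots_support\<close> leaves only the finitely
  many simple roots.\<close>

lemma chamber_iff: "v \<in> chamber \<longleftrightarrow> v \<in> cone \<and> (\<forall>s\<in>S. 0 \<le> v s)"
proof
  assume v: "v \<in> chamber"
  have "{k \<in> roots. pair k v \<le> 0} \<subseteq> simple ` S"
  proof
    fix k assume k: "k \<in> {k \<in> roots. pair k v \<le> 0}"
    have nn: "\<forall>i\<in>S. 0 \<le> k i * v i" using k v roots_nonneg by (auto simp: chamber_def)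
    then have "pair k v = 0" using k sum_nonneg[of S "\<lambda>i. k i * v i"] by (auto simp: pair_def)
    then have z: "\<forall>i\<in>S. k i * v i = 0" using nn fin sum_nonneg_eq_0_iff[of S "\<lambda>i. k i * v i"] by (simp add: pair_def)
    have "\<not> (\<exists>s t. m s t \<noteq> 0 \<and> 0 < k s \<and> 0 < k t)"
    proof clarify
      fix s t assume st: "m s t \<noteq> 0" "0 < k s" "0 < k t"
      then have "v s = 0" "v t = 0" using z supp[OF st(1)] supp2[OF st(1)] by auto
      then show False using v st(1) by (force simp: chamber_def)
    qed
    then show "k \<in> simple ` S" using roots_support k by blast
  qed
  then have "finite {k \<in> roots. pair k v \<le> 0}" using fin by (meson finite_imageI finite_subset)
  then show "v \<in> cone \<and> (\<forall>s\<in>S. 0 \<le> v s)" using v by (auto simp: cone_def chamber_def)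
next
  assume "v \<in> cone \<and> (\<forall>s\<in>S. 0 \<le> v s)"
  then show "v \<in> chamber" using cone_adjacent by (auto simp: chamber_def cone_def)
qed

text \<open>Reflecting at \<open>s\<close> makes \<open>simple s\<close> positive and maps the
  remaining negative roots injectively to roots negative on \<open>v\<close>. The count measures the
  distance to the chamber, so folding terminates.\<close>

lemma neg_roots_decrease:
  assumes v: "v \<in> cone" and s: "s \<in> S" "v s < 0"
  shows "card {k \<in> roots. pair k (refl 2 s v) < 0} < card {k \<in> roots. pair k v < 0}"
proof -
  have fin': "finite {k \<in> roots. pair k v < 0}"
    by (rule finite_subset[of _ "{k \<in> roots. pair k v \<le> 0}"]) (use v in \<open>auto simp: cone_def\<close>)
  have "card {k \<in> roots. pair k (refl 2 s v) < 0} \<le> card ({k \<in> roots. pair k v < 0} - {simple s})"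
  proof (rule card_inj_on_le)
    show "inj_on (coroot_refl s) {k \<in> roots. pair k (refl 2 s v) < 0}"
      using s by (intro inj_on_inverseI[of _ "coroot_refl s"]) auto
    show "coroot_refl s ` {k \<in> roots. pair k (refl 2 s v) < 0} \<subseteq> {k \<in> roots. pair k v < 0} - {simple s}"
    proof (rule image_subsetI)
      fix k assume k: "k \<in> {k \<in> roots. pair k (refl 2 s v) < 0}"
      have "k \<noteq> simple s" using k s pair_simple[of s "refl 2 s v"] by (auto simp: refl_def)
      moreover have "coroot_refl s k \<noteq> simple s"
      proof
        assume "coroot_refl s k = simple s"
        then have "k s = -1" using coroot_refl_refl[OF s(1), of k] nb_simple[OF s(1)] irr
          by (metis coroot_refl_def diff_0 fun_upd_same mult_zero_right simple_def)
        then show False using roots_nonneg[of k s] k by auto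
      qed
      ultimately show "coroot_refl s k \<in> {k \<in> roots. pair k v < 0} - {simple s}"
        using k s roots_refl_closed by (auto simp: pair_refl)
    qed
  qed (use fin' in auto)
  also have "\<dots> < card {k \<in> roots. pair k v < 0}"
    using s roots.simple[OF s(1)] pair_simple[OF s(1), of v] by (intro card_Diff1_less fin') simp
  finally show ?thesis .
qed

text \<open>The induction hypothesis covers every negative coordinate and not just the chosen one,
  so that two different first folds can be compared.\<close>

lemma cone_induct [consumes 1, case_names chamber reflect]:
  assumes "v \<in> cone" and "\<And>v. v \<in> chamber \<Longrightarrow> P v"
    and "\<And>v s. v \<in> cone \<Longrightarrow> v \<notin> chamber \<Longrightarrow> s \<in> S \<Longrightarrow> v s < 0 \<Longrightarrow>
      (\<And>t. t \<in> S \<Longrightarrow> v t < 0 \<Longrightarrow> P (refl 2 t v)) \<Longrightarrow> P v"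
  shows "P v"
  using assms(1)
proof (induction "card {k \<in> roots. pair k v < 0}" arbitrary: v rule: less_induct)
  case less
  show ?case
  proof (cases "v \<in> chamber")
    case False
    then have "\<not> (\<forall>s\<in>S. 0 \<le> v s)" using less.prems chamber_iff by blast
    then obtain s where s: "s \<in> S" "v s < 0" by (meson not_le)
    show ?thesis
    proof (rule assms(3)[OF less.prems False s])
      fix t assume "t \<in> S" "v t < 0"
      then show "P (refl 2 t v)"
        by (intro less.hyps neg_roots_decrease cone_refl less.prems)
    qed
  qed (rule assms(2))
qed

lemma chamber_word: "v \<in> cone \<Longrightarrow> \<exists>w. set w \<subseteq> S \<and> fold (refl 2) w v \<in> chamber"
proof (induction rule: cone_induct)
  case (chamber v)
  then show ?case by (intro exI[of _ "[]"]) auto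
next
  case (reflect v s)
  then obtain w where "set w \<subseteq> S" "fold (refl 2) w (refl 2 s v) \<in> chamber"
    using reflect.IH[OF reflect.hyps(3,4)] by blast
  then show ?case using reflect by (intro exI[of _ "s # w"]) auto
qed

lemma cone_fold: "v \<in> cone \<Longrightarrow> set w \<subseteq> S \<Longrightarrow> fold (refl 2) w v \<in> cone"
  by (induction w arbitrary: v) (auto simp: cone_refl)

text \<open>
  The developing map: the map on the cone that is the identity on the chamber and intertwines
  the reflections \<open>refl 2\<close> with \<open>refl 1\<close>.
\<close>

inductive dev :: "('i \<Rightarrow> real) \<Rightarrow> ('i \<Rightarrow> real) \<Rightarrow> bool" where
  dev_chamber: "v \<in> chamber \<Longrightarrow> dev v v"
| dev_refl: "s \<in> S \<Longrightarrow> v s < 0 \<Longrightarrow> dev (refl 2 s v) y \<Longrightarrow> dev v (refl 1 s y)"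

lemma dev_exists: "v \<in> cone \<Longrightarrow> \<exists>y. dev v y"
proof (induction rule: cone_induct)
  case (chamber v)
  then show ?case using dev_chamber by blast
next
  case (reflect v s)
  then show ?case using dev_refl by blast
qed

lemma dev_chamberD:
  assumes v: "v \<in> chamber" and "dev v y"
  shows "y = v"
  using assms(2)
proof (cases rule: dev.cases)
  case (dev_refl s y)
  then have "0 \<le> v s" using v by (simp add: chamber_def)
  then show ?thesis using dev_refl by simp
qed

text \<open>A diamond argument: two negative coordinates are not adjacent, so their reflections
  commute under both actions, and either first fold can be followed by the other one to a common
  vector, whose value is \<open>x\<close>.\<close>

lemma dev_unique: "v \<in> cone \<Longrightarrow> dev v y \<Longrightarrow> dev v z \<Longrightarrow> y = z"
proof (induction arbitrary: y z rule: cone_induct)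
  case (chamber v)
  then show ?case using dev_chamberD by metis
next
  case (reflect v u)
  have ex: "\<exists>s y'. s \<in> S \<and> v s < 0 \<and> dev (refl 2 s v) y' \<and> y = refl 1 s y'" if "dev v y" for y
    using that
  proof (cases rule: dev.cases)
    case dev_chamber
    then show ?thesis using reflect.hyps(2) by simp
  qed blast
  obtain s y' where s: "s \<in> S" "v s < 0" "dev (refl 2 s v) y'" "y = refl 1 s y'"
    using ex[OF reflect.prems(1)] by blast
  obtain t z' where t: "t \<in> S" "v t < 0" "dev (refl 2 t v) z'" "z = refl 1 t z'"
    using ex[OF reflect.prems(2)] by blast
  show ?case
  proof (cases "s = t")
    case True
    then show ?thesis using reflect.IH[OF s(1,2) s(3), of z'] s(4) t by simp
  next
    case False
    have st: "m s t = 0" using cone_adjacent[OF reflect.hyps(1), of s t] s t by fastforce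
    then have ts: "m t s = 0" using sym by metis
    obtain x where x: "dev (refl 2 s (refl 2 t v)) x"
      using dev_exists[OF cone_refl[OF cone_refl[OF reflect.hyps(1) t(1)] s(1)]] by blast
    have "dev (refl 2 t v) (refl 1 s x)"
      using False s t ts by (intro dev_refl x) (auto simp: refl_def)
    then have "z' = refl 1 s x" using reflect.IH[OF t(1,2) t(3)] by blast
    moreover have "dev (refl 2 s v) (refl 1 t x)"
      using False s t st x by (intro dev_refl) (auto simp: refl_def refl_commute[OF st])
    then have "y' = refl 1 t x" using reflect.IH[OF s(1,2) s(3)] by blast
    ultimately show ?thesis using s t refl_commute[OF st, of 1 x] by simp
  qed
qed

definition develop :: "('i \<Rightarrow> real) \<Rightarrow> 'i \<Rightarrow> real" where
  "develop v = (THE y. dev v y)"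

lemma develop_eq: "v \<in> cone \<Longrightarrow> dev v y \<Longrightarrow> develop v = y"
  unfolding develop_def using dev_unique by blast

lemma dev_develop: "v \<in> cone \<Longrightarrow> dev v (develop v)"
  using dev_exists develop_eq by metis

lemma develop_chamber: "v \<in> chamber \<Longrightarrow> develop v = v"
  using develop_eq dev_chamber chamber_iff by blast

lemma develop_neg: "v \<in> cone \<Longrightarrow> s \<in> S \<Longrightarrow> v s < 0 \<Longrightarrow> develop v = refl 1 s (develop (refl 2 s v))"
  by (intro develop_eq dev_refl dev_develop cone_refl)

text \<open>The pieces of the developing map on the two sides of a wall agree on it. A fold at a
  negative coordinate \<open>t\<close> leaves the vanishing coordinate \<open>s\<close> alone and
  commutes with the reflection at \<open>s\<close>, so the claim passes to the folded
  vector.\<close>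

lemma develop_wall: "v \<in> cone \<Longrightarrow> s \<in> S \<Longrightarrow> v s = 0 \<Longrightarrow> refl 1 s (develop v) = develop v"
proof (induction rule: cone_induct)
  case (chamber v)
  then show ?case by (auto simp: develop_chamber refl_def)
next
  case (reflect v t)
  have st: "m s t = 0" using cone_adjacent[OF reflect.hyps(1), of s t] reflect by fastforce
  have ts: "m t s = 0" using st sym by metis
  have "s \<noteq> t" using reflect by auto
  then have "refl 2 t v s = 0" using reflect.prems ts by (simp add: refl_def)
  then have "refl 1 s (develop (refl 2 t v)) = develop (refl 2 t v)" using reflect by blast
  then show ?case
    using develop_neg[OF reflect.hyps(1,3,4)] refl_commute[OF st, of 1 "develop (refl 2 t v)"] by simp
qed

lemma develop_refl:
  assumes v: "v \<in> cone" and s: "s \<in> S"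
  shows "develop (refl 2 s v) = refl 1 s (develop v)"
proof -
  consider "v s < 0" | "v s = 0" | "0 < v s" by linarith
  then show ?thesis
  proof cases
    case 1
    then show ?thesis using develop_neg[OF v s] by simp
  next
    case 2
    then have "refl 2 s v = v" by (auto simp: refl_def)
    then show ?thesis using develop_wall[OF v s 2] by simp
  next
    case 3
    then show ?thesis using develop_neg[OF cone_refl[OF v s] s] by (simp add: refl_def[of 2 s v s])
  qed
qed

lemma develop_fold:
  "v \<in> cone \<Longrightarrow> set w \<subseteq> S \<Longrightarrow> develop (fold (refl 2) w v) = fold (refl 1) w (develop v)"
  by (induction w arbitrary: v) (auto simp: develop_refl cone_refl)

section \<open>Local form of the developing map\<close>

definition star :: "'i set \<Rightarrow> ('i \<Rightarrow> real) set" where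
  "star T = {v. \<forall>s\<in>S - T. 0 < v s + 2 * (\<Sum>t\<in>T. m t s * min (v t) 0)}"

text \<open>Folding a negative \<open>t\<close> by \<open>refl 2\<close> and unfolding by
  \<open>refl 1\<close> keeps coordinate \<open>t\<close> and adds
  \<open>(2 - 1) * m t s * v t\<close> to coordinate \<open>s\<close>. \<open>phi\<close> does so
  for all negative \<open>t\<close> in \<open>T\<close> at once. The correction depends only on
  coordinates in \<open>T\<close>, which are kept, so subtracting it, as \<open>psi\<close> does, is
  the inverse.\<close>

definition phi :: "'i set \<Rightarrow> ('i \<Rightarrow> real) \<Rightarrow> 'i \<Rightarrow> real" where
  "phi T v s = (if s \<in> T then v s else v s + (\<Sum>t\<in>T. m t s * min (v t) 0))"

definition psi :: "'i set \<Rightarrow> ('i \<Rightarrow> real) \<Rightarrow> 'i \<Rightarrow> real" where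
  "psi T v s = (if s \<in> T then v s else v s - (\<Sum>t\<in>T. m t s * min (v t) 0))"

lemma phi_psi [simp]: "phi T (psi T v) = v" and psi_phi [simp]: "psi T (phi T v) = v"
  by (auto simp: phi_def psi_def fun_eq_iff intro!: sum.cong)

lemma psi_nonneg:
  assumes "\<And>t. t \<in> T \<Longrightarrow> 0 \<le> v t" shows "psi T v = v"
proof -
  have "(\<Sum>t\<in>T. m t s * min (v t) 0) = 0" for s using assms by (intro sum.neutral) simp
  then show ?thesis by (simp add: psi_def fun_eq_iff)
qed

text \<open>\<open>star T\<close> asks that the coordinates off \<open>T\<close> be positive once
  all negative ones in \<open>T\<close> have been folded. A fold at one \<open>t\<close> in
  \<open>T\<close> leaves the rest of \<open>T\<close> alone and preserves this condition, since the
  change of \<open>v s\<close> compensates that of the sum.\<close>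

lemma star_develop:
  assumes T: "T \<subseteq> S" "\<And>s t. s \<in> T \<Longrightarrow> t \<in> T \<Longrightarrow> m s t = 0"
    and v: "v \<in> star T" "\<And>i. i \<notin> S \<Longrightarrow> v i = 0"
  shows "v \<in> cone \<and> develop v = phi T v"
  using v
proof (induction "card {t \<in> T. v t < 0}" arbitrary: v rule: less_induct)
  case less
  have finT: "finite T" using T fin finite_subset by blast
  show ?case
  proof (cases "\<exists>t\<in>T. v t < 0")
    case False
    then have nn: "\<forall>t\<in>T. 0 \<le> v t" by auto
    then have sum0: "(\<Sum>t\<in>T. m t s * min (v t) 0) = 0" for s by (intro sum.neutral) auto
    then have pos: "\<forall>s\<in>S - T. 0 < v s" using less.prems by (auto simp: star_def)
    have "v \<in> chamber"
      unfolding chamber_def using less.prems(2) nn pos T(2) supp supp2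
      by (auto simp: less_imp_le) (metis DiffI less_imp_le)+
    moreover have "phi T v = v" using sum0 by (auto simp: phi_def)
    ultimately show ?thesis using develop_chamber chamber_iff by auto
  next
    case True
    then obtain t where t: "t \<in> T" "v t < 0" by blast
    then have tS: "t \<in> S" using T by auto
    let ?v = "refl 2 t v"
    have vT: "?v u = v u" if "u \<in> T - {t}" for u using T(2) t that by (auto simp: refl_def)
    have vt: "?v t = - v t" by (simp add: refl_def)
    have sum_eq: "(\<Sum>u\<in>T. m u s * min (?v u) 0) = (\<Sum>u\<in>T. m u s * min (v u) 0) - m t s * v t" for s
    proof -
      have "(\<Sum>u\<in>T - {t}. m u s * min (?v u) 0) = (\<Sum>u\<in>T - {t}. m u s * min (v u) 0)"
        using vT by (intro sum.cong) auto
      then show ?thesis using t finT vt by (simp add: sum.remove[of T t])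
    qed
    have vs: "?v s = v s + 2 * m t s * v t" if "s \<notin> T" for s using that t by (auto simp: refl_def)
    have "?v \<in> star T"
      unfolding star_def
    proof (intro CollectI ballI)
      fix s assume s: "s \<in> S - T"
      have "?v s + 2 * (\<Sum>u\<in>T. m u s * min (?v u) 0) = v s + 2 * (\<Sum>u\<in>T. m u s * min (v u) 0)"
        using s by (simp add: sum_eq vs)
      then show "0 < ?v s + 2 * (\<Sum>u\<in>T. m u s * min (?v u) 0)" using less.prems(1) s by (simp add: star_def)
    qed
    moreover have "card {u \<in> T. ?v u < 0} < card {u \<in> T. v u < 0}"
    proof (rule psubset_card_mono)
      have "{u \<in> T. ?v u < 0} \<subseteq> {u \<in> T. v u < 0} - {t}"
      proof
        fix u assume u: "u \<in> {u \<in> T. ?v u < 0}"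
        then have "u \<noteq> t" using t vt by auto
        then show "u \<in> {u \<in> T. v u < 0} - {t}" using u vT[of u] by simp
      qed
      then show "{u \<in> T. ?v u < 0} \<subset> {u \<in> T. v u < 0}" using t by blast
    qed (use finT in auto)
    ultimately have IH: "?v \<in> cone" "develop ?v = phi T ?v"
      using less.hyps[of ?v] refl_outside[OF tS, of v] less.prems(2) by blast+
    have "v \<in> cone" using cone_refl[OF IH(1) tS] by simp
    moreover have "develop v = refl 1 t (phi T ?v)"
      using develop_refl[OF IH(1) tS] IH(2) by simp
    moreover have "refl 1 t (phi T ?v) = phi T v"
    proof
      fix s
      show "refl 1 t (phi T ?v) s = phi T v s"
        using t vT[of s] vt vs[of s] sum_eq[of s] T(2)[of t s]
        by (cases "s \<in> T") (auto simp: refl_def[of 1] phi_def)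
    qed
    ultimately show ?thesis by simp
  qed
qed

lemma continuous_refl [continuous_intros]:
  assumes "continuous_on A f" shows "continuous_on A (\<lambda>x. refl c s (f x))"
proof (rule continuous_on_coordinatewise_then_product)
  fix i
  have [continuous_intros]: "continuous_on A (\<lambda>x. f x j)" for j
    using assms by (rule continuous_on_product_then_coordinatewise)
  show "continuous_on A (\<lambda>x. refl c s (f x) i)"
    unfolding refl_def by (cases "i = s") (auto intro!: continuous_intros)
qed

lemma continuous_fold_refl [continuous_intros]:
  "continuous_on A f \<Longrightarrow> continuous_on A (\<lambda>x. fold (refl c) w (f x))"
  by (induction w arbitrary: f) (auto intro: continuous_refl)

lemma continuous_phi [continuous_intros]:
  assumes "continuous_on A f" shows "continuous_on A (\<lambda>x. phi T (f x))"
proof (rule continuous_on_coordinatewise_then_product)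
  fix i
  have [continuous_intros]: "continuous_on A (\<lambda>x. f x j)" for j
    using assms by (rule continuous_on_product_then_coordinatewise)
  show "continuous_on A (\<lambda>x. phi T (f x) i)"
    unfolding phi_def by (cases "i \<in> T") (auto intro!: continuous_intros)
qed

lemma continuous_psi [continuous_intros]:
  assumes "continuous_on A f" shows "continuous_on A (\<lambda>x. psi T (f x))"
proof (rule continuous_on_coordinatewise_then_product)
  fix i
  have [continuous_intros]: "continuous_on A (\<lambda>x. f x j)" for j
    using assms by (rule continuous_on_product_then_coordinatewise)
  show "continuous_on A (\<lambda>x. psi T (f x) i)"
    unfolding psi_def by (cases "i \<in> T") (auto intro!: continuous_intros)
qed

lemma open_star: "open (star T)"
proof -
  have "star T = (\<Inter>s\<in>S - T. {v. 0 < v s + 2 * (\<Sum>t\<in>T. m t s * min (v t) 0)})"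
    by (auto simp: star_def)
  moreover have "open {v. 0 < v s + 2 * (\<Sum>t\<in>T. m t s * min (v t) (0::real))}" for s
    by (intro open_Collect_less) (auto intro!: continuous_intros intro: continuous_on_product_then_coordinatewise)
  ultimately show ?thesis using fin by auto
qed

text \<open>\<open>T\<close> collects the coordinates that vanish once \<open>v\<close> is folded
  into the chamber, where vanishing coordinates are pairwise non-adjacent. Near \<open>v\<close> the
  developing map is thus \<open>phi T\<close> between two linear isomorphisms, which gives its
  continuity and later its local injectivity.\<close>

lemma cone_chart:
  assumes v: "v \<in> cone"
  obtains w T where "set w \<subseteq> S" "T \<subseteq> S" "\<And>s t. s \<in> T \<Longrightarrow> t \<in> T \<Longrightarrow> m s t = 0"
    "fold (refl 2) w v \<in> star T"
    "\<And>x. x \<in> cone \<Longrightarrow> fold (refl 2) w x \<in> star T \<Longrightarrow> fold (refl 1) w (develop x) = phi T (fold (refl 2) w x)"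
proof -
  obtain w where w: "set w \<subseteq> S" "fold (refl 2) w v \<in> chamber" using chamber_word[OF v] by blast
  define c where "c = fold (refl 2) w v"
  define T where "T = {s \<in> S. c s = 0}"
  have T: "m s t = 0" if "s \<in> T" "t \<in> T" for s t
    using w(2) that unfolding T_def c_def[symmetric] chamber_def by force
  have "c \<in> star T"
    using w(2) unfolding star_def T_def c_def[symmetric] chamber_def by (auto simp: order_less_le)
  moreover have "fold (refl 1) w (develop x) = phi T (fold (refl 2) w x)"
    if "x \<in> cone" "fold (refl 2) w x \<in> star T" for x
    using star_develop[OF _ T that(2)] cone_fold[OF that(1) w(1)] develop_fold[OF that(1) w(1)]
    by (auto simp: T_def cone_def)
  ultimately show thesis using that[of w T] w T by (auto simp: T_def c_def)
qed

lemma continuous_develop: "continuous_on cone develop"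
  unfolding continuous_on_def
proof
  fix v assume v: "v \<in> cone"
  obtain w T where w: "set w \<subseteq> S" and star: "fold (refl 2) w v \<in> star T"
    and eq: "\<And>x. x \<in> cone \<Longrightarrow> fold (refl 2) w x \<in> star T \<Longrightarrow> fold (refl 1) w (develop x) = phi T (fold (refl 2) w x)"
    using cone_chart[OF v] by metis
  define g where "g x = fold (refl 1) (rev w) (phi T (fold (refl 2) w x))" for x
  have g: "g x = develop x" if "x \<in> cone" "fold (refl 2) w x \<in> star T" for x
    unfolding g_def eq[OF that, symmetric] by (rule fold_refl_rev)
  have "continuous_on UNIV g"
    unfolding g_def by (intro continuous_intros continuous_on_id)
  then have "(g \<longlongrightarrow> g v) (at v within cone)"
    by (meson UNIV_I continuous_on_def tendsto_within_subset subset_UNIV)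
  moreover have "open ((\<lambda>x. fold (refl 2) w x) -` star T)"
    by (intro open_vimage open_star continuous_intros continuous_on_id)
  then have "\<forall>\<^sub>F x in at v within cone. g x = develop x"
    unfolding eventually_at_topological using g star by blast
  ultimately show "(develop \<longlongrightarrow> develop v) (at v within cone)"
    unfolding g[OF v star] by (rule Lim_transform_eventually)
qed

end

section \<open>Configurations on the circle\<close>

lemma sort_three:
  fixes a b c :: "'a::linorder"
  assumes "a \<noteq> b" "b \<noteq> c" "a \<noteq> c" "P a" "P b" "P c"
  obtains i j k where "i < j" "j < k" "P i" "P j" "P k"
  using assms by (cases a b rule: linorder_cases; cases b c rule: linorder_cases; cases a c rule: linorder_cases) auto

lemma cis_dist: "norm (cis a - cis b) \<le> \<bar>a - b\<bar>"
proof -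
  have "cis a - cis b = cis b * (cis (a - b) - 1)" by (simp add: algebra_simps cis_mult)
  then have "norm (cis a - cis b) = norm (cis (a - b) - 1)" by (simp add: norm_mult)
  also have "\<dots> = norm (exp (\<i> * of_real (a - b)) - 1)" by (simp add: cis_conv_exp)
  also have "\<dots> \<le> \<bar>a - b\<bar>"
    using abs_sin_x_le_abs_x[of "(a - b) / 2"] by (subst dist_exp_i_1) simp
  finally show ?thesis .
qed

lemma continuous_map_euclidean_fun:
  "(\<And>i. continuous_map X euclideanreal (\<lambda>x. f x i)) \<Longrightarrow> continuous_map X euclidean f"
  by (simp flip: euclidean_product_topology add: continuous_map_componentwise_UNIV)

locale cyclic_configurations =
  fixes n :: nat and p :: complex
  assumes n2: "2 \<le> n" and p: "norm p = 1"
begin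

abbreviation "N \<equiv> int n"
abbreviation "S \<equiv> {0..<int n}"

text \<open>The sum of two indicators gives weight 2 when n = 2, where the two gaps adjoin each
  other on both sides and an exchange changes the other gap twice.\<close>

definition weight :: "int \<Rightarrow> int \<Rightarrow> real" where
  "weight s t = (if s \<in> S \<and> t \<in> S then of_bool (t = (s + 1) mod N) + of_bool (s = (t + 1) mod N) else 0)"

lemma succ_mod: "s \<in> S \<Longrightarrow> (s + 1) mod N = (if s = N - 1 then 0 else s + 1)"
  using n2 by (auto simp: mod_pos_pos_trivial)

lemma succ_mod_neq: "s \<in> S \<Longrightarrow> (s + 1) mod N \<noteq> s"
  using n2 by (auto simp: succ_mod)

sublocale weighted_graph S weight
proof
  show "weight s s = 0" for s using succ_mod_neq[of s] by (auto simp: weight_def)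
qed (auto simp: weight_def of_bool_def split: if_splits)

lemma weight_succ: "s \<in> S \<Longrightarrow> weight s ((s + 1) mod N) \<noteq> 0"
  using n2 by (auto simp: weight_def of_bool_def)

lemma weight_le: "weight s t \<le> 2"
  by (auto simp: weight_def of_bool_def)

text \<open>
  \<open>gaps L z y\<close>: the points \<open>z i\<close>, extended quasi-periodically to all integers \<open>i\<close>, lift a
  configuration on a circle of length \<open>L\<close>, and \<open>y\<close> lists the differences of consecutive points.
  The reflections \<open>refl 1\<close> act on \<open>z\<close> by exchanging neighbours.
\<close>

definition gaps :: "real \<Rightarrow> (int \<Rightarrow> real) \<Rightarrow> (int \<Rightarrow> real) \<Rightarrow> bool" where
  "gaps L z y \<longleftrightarrow> (\<forall>i. z (i + N) = z i + L) \<and> (\<forall>s. y s = (if s \<in> S then z (s + 1) - z s else 0))"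

lemma quasi_periodic_int:
  fixes f :: "int \<Rightarrow> 'a::comm_ring_1"
  assumes "\<And>i. f (i + N) = f i + L"
  shows "f (i + q * N) = f i + of_int q * L"
proof (induction q rule: int_induct[of _ 0])
  case (step1 q)
  then show ?case using assms[of "i + q * N"] by (simp add: algebra_simps)
next
  case (step2 q)
  then show ?case using assms[of "i + (q - 1) * N"] by (simp add: algebra_simps)
qed simp

lemma gaps_mod: "gaps L z y \<Longrightarrow> z i = z (i mod N) + of_int (i div N) * L"
  using quasi_periodic_int[of z L "i mod N" "i div N"] by (simp add: gaps_def)

lemma gaps_diff:
  assumes "gaps L z y" shows "z (i + 1) - z i = y (i mod N)"
proof -
  have "i mod N \<in> S" using n2 by simp
  then have "y (i mod N) = z (i mod N + 1) - z (i mod N)" using assms by (simp add: gaps_def)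
  moreover have "z (i mod N + 1 + i div N * N) = z (i mod N + 1) + of_int (i div N) * L"
    "z (i mod N + i div N * N) = z (i mod N) + of_int (i div N) * L"
    using assms by (intro quasi_periodic_int; simp add: gaps_def)+
  moreover have "i mod N + 1 + i div N * N = i + 1" "i mod N + i div N * N = i"
    using div_mult_mod_eq[of i N] by linarith+
  ultimately show ?thesis by simp
qed

lemma gaps_sum:
  assumes "gaps L z y" "j \<le> n" shows "(\<Sum>l\<in>{0..<int j}. y l) = z (int j) - z 0"
  using assms(2)
proof (induction j)
  case (Suc j)
  have "{0..<int (Suc j)} = insert (int j) {0..<int j}" by auto
  then have "(\<Sum>l\<in>{0..<int (Suc j)}. y l) = y (int j) + (z (int j) - z 0)" using Suc by simp
  moreover have "int j \<in> S" using Suc.prems by simp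
  then have "y (int j) = z (int j + 1) - z (int j)" using assms(1) unfolding gaps_def by presburger
  ultimately show ?case by (simp add: add.commute)
qed simp

lemma gaps_total: "gaps L z y \<Longrightarrow> (\<Sum>l\<in>S. y l) = L"
  using gaps_sum[of L z y n] by (simp add: gaps_def) (metis add_0 add_diff_cancel_left')

lemma gaps_exist:
  assumes "\<And>i. i \<notin> S \<Longrightarrow> y i = 0"
  obtains z where "gaps (\<Sum>l\<in>S. y l) z y"
proof
  define L where "L = (\<Sum>l\<in>S. y l)"
  define z where "z i = (\<Sum>l\<in>{0..<i mod N}. y l) + of_int (i div N) * L" for i
  have "z (s + 1) - z s = y s" if s: "s \<in> S" for s
  proof (cases "s = N - 1")
    case True
    have "S = insert (N - 1) {0..<N - 1}" using n2 by auto
    then have "L = y (N - 1) + (\<Sum>l\<in>{0..<N - 1}. y l)" unfolding L_def by simp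
    moreover have "(N - 1) mod N = N - 1" "(N - 1) div N = 0"
      using n2 by (intro mod_pos_pos_trivial div_pos_pos_trivial; simp)+
    then have "z s = (\<Sum>l\<in>{0..<N - 1}. y l)" unfolding z_def True by simp
    moreover have "z (s + 1) = L" using n2 by (simp add: z_def True)
    ultimately show ?thesis using True by simp
  next
    case False
    have "{0..<s + 1} = insert s {0..<s}" using s by auto
    then have "(\<Sum>l\<in>{0..<s + 1}. y l) = y s + (\<Sum>l\<in>{0..<s}. y l)" by simp
    moreover have "(s + 1) mod N = s + 1" "(s + 1) div N = 0" "s mod N = s" "s div N = 0"
      using s False by (intro mod_pos_pos_trivial div_pos_pos_trivial; simp)+
    ultimately show ?thesis by (simp add: z_def)
  qed
  moreover have "z (i + N) = z i + L" for i
    using n2 by (simp add: z_def algebra_simps)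
  ultimately show "gaps (\<Sum>l\<in>S. y l) z y" using assms by (simp add: gaps_def L_def)
qed

section \<open>Exchanges of neighbours as affine permutations of the integers\<close>

definition swap :: "int \<Rightarrow> int \<Rightarrow> int" where
  "swap s i = (if i mod N = s then i + 1 else if i mod N = (s + 1) mod N then i - 1 else i)"

lemma swap_add: "swap s (i + N) = swap s i + N"
  by (simp add: swap_def)

lemma pred_mod:
  assumes "s \<in> S" shows "i mod N = (s + 1) mod N \<longleftrightarrow> (i - 1) mod N = s"
proof -
  have "i mod N = (s + 1) mod N \<longleftrightarrow> (i - 1) mod N = (s + 1 - 1) mod N"
    by (metis diff_add_cancel mod_add_left_eq mod_diff_left_eq)
  then show ?thesis using assms by (simp add: mod_pos_pos_trivial)
qed

lemma swap_swap:
  assumes s: "s \<in> S" shows "swap s (swap s i) = i"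
proof -
  have "(i + 1) mod N = (s + 1) mod N" if "i mod N = s" using that by (metis mod_add_left_eq)
  moreover have "(i - 1) mod N = s" if "i mod N = (s + 1) mod N" using that pred_mod[OF s] by blast
  moreover have "(s + 1) mod N \<noteq> s" using succ_mod_neq[OF s] .
  ultimately show ?thesis by (auto simp: swap_def)
qed

text \<open>Exchanging two consecutive points reverses the gap between them and adds it to the gaps
  on either side, which is \<open>refl 1\<close>.\<close>

lemma gaps_swap:
  assumes g: "gaps L z y" and s: "s \<in> S"
  shows "gaps L (z \<circ> swap s) (refl 1 s y)"
proof -
  have ss: "(s + 1) mod N \<noteq> s" using succ_mod_neq[OF s] .
  have smod: "t mod N = t" if "t \<in> S" for t using that by (simp add: mod_pos_pos_trivial)
  have "refl 1 s y t = z (swap s (t + 1)) - z (swap s t)" if t: "t \<in> S" for t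
  proof (cases "t = s")
    case True
    then have "swap s t = s + 1" "swap s (t + 1) = s" using smod[OF s] ss by (auto simp: swap_def)
    then show ?thesis using True gaps_diff[OF g, of s] smod[OF s] by (simp add: refl_def)
  next
    case False
    have ne: "(t + 1) mod N \<noteq> (s + 1) mod N" using pred_mod[OF s, of "t + 1"] smod[OF t] False by simp
    have y: "y s = z (t + 2) - z (t + 1)" if "(t + 1) mod N = s" using gaps_diff[OF g, of "t + 1"] that by (simp add: add.commute)
    have y': "y s = z t - z (t - 1)" if "t = (s + 1) mod N"
      using gaps_diff[OF g, of "t - 1"] pred_mod[OF s, of t] that smod[OF t] by simp
    have yt: "y t = z (t + 1) - z t" using gaps_diff[OF g, of t] smod[OF t] by simp
    \<comment> \<open>The corrections at the two ends of gap \<open>t\<close> are computed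
      separately, since both occur when n = 2.\<close>
    have "z (swap s (t + 1)) = z (t + 1) + of_bool ((t + 1) mod N = s) * y s"
      using y ne by (simp add: swap_def add.assoc)
    moreover have "z (swap s t) = z t - of_bool (t = (s + 1) mod N) * y s"
      using y' smod[OF t] False by (simp add: swap_def)
    moreover have "weight s t = of_bool (t = (s + 1) mod N) + of_bool ((t + 1) mod N = s)"
      using s t by (auto simp: weight_def)
    ultimately show ?thesis using False yt by (simp add: refl_def algebra_simps)
  qed
  moreover have "refl 1 s y t = 0" if "t \<notin> S" for t
  proof (rule refl_outside[OF s _ that])
    show "y i = 0" if "i \<notin> S" for i using g that unfolding gaps_def by presburger
  qed
  moreover have "(z \<circ> swap s) (i + N) = (z \<circ> swap s) i + L" for i
    using g swap_add by (simp add: gaps_def)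
  ultimately show ?thesis unfolding gaps_def o_def by simp
qed

text \<open>The permutation depends on the word only. Hence the one that orders a configuration can
  also be applied to nearby configurations.\<close>

lemma gaps_fold:
  assumes "set w \<subseteq> S"
  obtains \<tau> where "bij \<tau>" "\<And>i. \<tau> (i + N) = \<tau> i + N"
    "\<And>L z y. gaps L z y \<Longrightarrow> gaps L (z \<circ> \<tau>) (fold (refl 1) w y)"
proof -
  have "\<exists>\<tau>. bij \<tau> \<and> (\<forall>i. \<tau> (i + N) = \<tau> i + N) \<and> (\<forall>L z y. gaps L z y \<longrightarrow> gaps L (z \<circ> \<tau>) (fold (refl 1) w y))"
    using assms
  proof (induction w)
    case Nil
    show ?case by (rule exI[of _ id], intro conjI bij_id) simp_all
  next
    case (Cons s w)
    then have "set w \<subseteq> S" by simp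
    from Cons.IH[OF this] obtain \<tau> where \<tau>: "bij \<tau>" "\<forall>i. \<tau> (i + N) = \<tau> i + N"
      "\<forall>L z y. gaps L z y \<longrightarrow> gaps L (z \<circ> \<tau>) (fold (refl 1) w y)" by blast
    have s: "s \<in> S" using Cons by simp
    have "bij (swap s)" by (rule o_bij[of "swap s"]) (use swap_swap[OF s] in auto)
    then have "bij (swap s \<circ> \<tau>)" using \<tau>(1) bij_comp by blast
    moreover have "gaps L (z \<circ> (swap s \<circ> \<tau>)) (fold (refl 1) (s # w) y)" if "gaps L z y" for L z y
      using \<tau>(3) gaps_swap[OF that s] by (simp add: o_assoc)
    moreover have "(swap s \<circ> \<tau>) (i + N) = (swap s \<circ> \<tau>) i + N" for i
      using \<tau>(2) swap_add by simp
    ultimately show ?case by blast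
  qed
  then show thesis using that by blast
qed

lemma bij_periodic_mod:
  assumes "bij \<tau>" "\<And>i. \<tau> (i + N) = \<tau> i + N"
  shows "\<tau> i mod N = \<tau> j mod N \<longleftrightarrow> i mod N = j mod N"
proof -
  have shift: "\<tau> (i + q * N) = \<tau> i + q * N" for i q
    using quasi_periodic_int[of \<tau> N i q] assms(2) by simp
  show ?thesis
  proof
    assume "\<tau> i mod N = \<tau> j mod N"
    then obtain q where "\<tau> i = \<tau> j + N * q" by (metis mod_eqE)
    then have "\<tau> i = \<tau> (j + q * N)" by (simp add: shift mult.commute)
    then have "i = j + q * N" using assms(1) by (metis bij_def injD)
    then show "i mod N = j mod N" by simp
  next
    assume "i mod N = j mod N"
    then obtain q where "i = j + N * q" by (metis mod_eqE)
    then show "\<tau> i mod N = \<tau> j mod N" using shift[of j q] by (simp add: mult.commute)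
  qed
qed

definition point :: "real \<Rightarrow> (int \<Rightarrow> real) \<Rightarrow> int \<Rightarrow> complex" where
  "point L z i = p * cis (2 * pi * ((z i - z 0) / L))"

lemma point_mod:
  assumes "gaps L z y" "L \<noteq> 0" shows "point L z (i mod N) = point L z i"
proof -
  have "2 * pi * ((z i - z 0) / L) = 2 * pi * ((z (i mod N) - z 0) / L) + 2 * pi * of_int (i div N)"
    using gaps_mod[OF assms(1), of i] assms(2) by (simp add: field_simps)
  then show ?thesis unfolding point_def by (simp add: cis_mult[symmetric] cis_multiple_2pi)
qed

text \<open>This is \<open>point\<close> in terms of gaps. Measuring from \<open>z 0\<close> puts
  label 0 at the fixed point \<open>p\<close>, and dividing by the total length makes the
  configuration invariant under scaling.\<close>

definition config :: "(int \<Rightarrow> real) \<Rightarrow> nat \<Rightarrow> complex" where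
  "config y = (\<lambda>j\<in>{1..<n}. p * cis (2 * pi * ((\<Sum>l\<in>{0..<int j}. y l) / (\<Sum>l\<in>S. y l))))"

text \<open>The paper's \<open>n\<close>-th point, fixed at \<open>p\<close>, gets the index 0, so that indices live in \<open>\<int>/n\<close>.\<close>

definition coord :: "(nat \<Rightarrow> complex) \<Rightarrow> int \<Rightarrow> complex" where
  "coord x j = (if j = 0 then p else x (nat j))"

lemma coord_config:
  assumes g: "gaps L z y" and j: "j \<in> S"
  shows "coord (config y) j = point L z j"
proof (cases "j = 0")
  case False
  then have "nat j \<in> {1..<n}" using j by auto
  moreover have "(\<Sum>l\<in>{0..<j}. y l) = z j - z 0" using gaps_sum[OF g, of "nat j"] j by (simp add: nat_le_iff)
  ultimately show ?thesis using False j by (simp add: coord_def config_def point_def gaps_total[OF g])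
qed (simp add: coord_def point_def)

text \<open>For \<open>d = 0\<close> this is the defining condition of the configuration space. A
  positive \<open>d\<close> is a margin that survives small perturbations and depends on the
  configuration only, not on its lift.\<close>

definition no_triple :: "(int \<Rightarrow> complex) \<Rightarrow> real \<Rightarrow> bool" where
  "no_triple X d \<longleftrightarrow> (\<forall>i\<in>S. \<forall>j\<in>S. \<forall>k\<in>S. i \<noteq> j \<longrightarrow> j \<noteq> k \<longrightarrow> i \<noteq> k \<longrightarrow>
     d < norm (X i - X j) \<or> d < norm (X j - X k))"

lemma topspace_Q_space:
  "x \<in> topspace (Q_space n p) \<longleftrightarrow> x \<in> PiE {1..<n} (\<lambda>_. circle) \<and> no_triple (coord x) 0"
proof -
  have tor: "topspace (torus n) = PiE {1..<n} (\<lambda>_. circle)" by (simp add: torus_def)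
  have "x \<in> triple_diagonals n p \<longleftrightarrow> \<not> no_triple (coord x) 0" if x: "x \<in> topspace (torus n)"
  proof
    assume "x \<in> triple_diagonals n p"
    then obtain i j k where ijk: "1 \<le> i" "i < j" "j < k" "k \<le> n"
      "config_point n p x i = config_point n p x j" "config_point n p x j = config_point n p x k"
      by (auto simp: triple_diagonals_def triple_diagonal_def)
    define f where "f i = (if i = n then 0 else int i)" for i
    have f: "f a \<in> S" "coord x (f a) = config_point n p x a" if "1 \<le> a" "a \<le> n" for a
      using that n2 by (auto simp: f_def coord_def config_point_def)
    have "f i \<noteq> f j" "f j \<noteq> f k" "f i \<noteq> f k" using ijk by (auto simp: f_def)
    moreover have "coord x (f i) = coord x (f j)" "coord x (f j) = coord x (f k)"
      "f i \<in> S" "f j \<in> S" "f k \<in> S"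
      using ijk f[of i] f[of j] f[of k] by simp_all
    ultimately show "\<not> no_triple (coord x) 0"
      unfolding no_triple_def by (metis norm_zero right_minus_eq less_irrefl)
  next
    assume "\<not> no_triple (coord x) 0"
    then obtain i j k where ijk: "i \<in> S" "j \<in> S" "k \<in> S" "i \<noteq> j" "j \<noteq> k" "i \<noteq> k"
      and eq: "coord x i = coord x j" "coord x j = coord x k"
      unfolding no_triple_def by (auto simp: not_less)
    define f where "f i = (if i = 0 then n else nat i)" for i
    let ?P = "\<lambda>a. 1 \<le> a \<and> a \<le> n \<and> config_point n p x a = coord x i"
    have f: "1 \<le> f a \<and> f a \<le> n \<and> config_point n p x (f a) = coord x a" if "a \<in> S" for a
      using that n2 by (auto simp: f_def coord_def config_point_def)
    have "f i \<noteq> f j" "f j \<noteq> f k" "f i \<noteq> f k" using ijk by (auto simp: f_def nat_eq_iff split: if_splits)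
    moreover have "?P (f i)" "?P (f j)" "?P (f k)" using f ijk eq by auto
    \<comment> \<open>The indices are merely distinct, and 0 becomes the largest index
      \<open>n\<close>, so they have to be sorted anew.\<close>
    ultimately obtain a b c where abc: "a < b" "b < c" "?P a" "?P b" "?P c" by (rule sort_three)
    then have "x \<in> triple_diagonal n p a b c" using x by (simp add: triple_diagonal_def)
    then show "x \<in> triple_diagonals n p" using abc unfolding triple_diagonals_def by blast
  qed
  then show ?thesis unfolding Q_space_def using tor by auto
qed

lemma norm_coord: "x \<in> topspace (Q_space n p) \<Longrightarrow> j \<in> S \<Longrightarrow> norm (coord x j) = 1"
proof (cases "j = 0")
  case False
  assume "x \<in> topspace (Q_space n p)" "j \<in> S"
  moreover have "nat j \<in> {1..<n}" using False \<open>j \<in> S\<close> by auto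
  ultimately have "x (nat j) \<in> circle" unfolding topspace_Q_space by blast
  then show ?thesis using False by (simp add: coord_def)
qed (simp add: coord_def p)

lemma chamber_sum_pos:
  assumes c: "c \<in> chamber" shows "0 < (\<Sum>l\<in>S. c l)"
proof -
  have S01: "0 \<in> S" "1 \<in> S" using n2 by auto
  have "weight 0 1 \<noteq> 0" using n2 by (simp add: weight_def)
  then have "0 < c 0 \<or> 0 < c 1" using c unfolding chamber_def by blast
  then obtain s where "s \<in> S" "0 < c s" using S01 by blast
  then show ?thesis using c by (intro sum_pos2[of S s]) (auto simp: chamber_def)
qed

lemma develop_outside: "v \<in> cone \<Longrightarrow> i \<notin> S \<Longrightarrow> develop v i = 0"
proof (induction rule: cone_induct)
  case (chamber v)
  then show ?case by (simp add: develop_chamber chamber_def)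
next
  case (reflect v s)
  then have "develop (refl 2 s v) i = 0" by blast
  then show ?case
    using develop_neg[OF reflect.hyps(1,3,4)] supp2[of s i] reflect by (auto simp: refl_def[of 1])
qed

text \<open>The vector \<open>develop v\<close> lifts a configuration in arbitrary labelling, and
  \<open>\<tau>\<close> lists its points in weakly increasing order, with the gaps \<open>c\<close>
  in the chamber. Reordering keeps the length, which is therefore positive.\<close>

lemma develop_gaps:
  assumes v: "v \<in> cone"
  obtains w \<tau> c z L where "set w \<subseteq> S" "fold (refl 2) w v = c" "c \<in> chamber" "0 < L"
    "gaps L z (develop v)" "fold (refl 1) w (develop v) = c" "gaps L (z \<circ> \<tau>) c"
    "bij \<tau>" "\<And>i. \<tau> (i + N) = \<tau> i + N"
    "\<And>L z y. gaps L z y \<Longrightarrow> gaps L (z \<circ> \<tau>) (fold (refl 1) w y)"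
proof -
  obtain w where w: "set w \<subseteq> S" "fold (refl 2) w v \<in> chamber" using chamber_word[OF v] by blast
  obtain z where z: "gaps (\<Sum>l\<in>S. develop v l) z (develop v)" using gaps_exist develop_outside[OF v] by blast
  obtain \<tau> where \<tau>: "bij \<tau>" "\<And>i. \<tau> (i + N) = \<tau> i + N"
    "\<And>L z y. gaps L z y \<Longrightarrow> gaps L (z \<circ> \<tau>) (fold (refl 1) w y)" using gaps_fold[OF w(1)] by metis
  have c: "fold (refl 1) w (develop v) = fold (refl 2) w v"
    using develop_fold[OF v w(1)] develop_chamber[OF w(2)] by simp
  have g: "gaps (\<Sum>l\<in>S. develop v l) (z \<circ> \<tau>) (fold (refl 2) w v)" using \<tau>(3)[OF z] c by simp
  then have "0 < (\<Sum>l\<in>S. develop v l)" using gaps_total[OF g] chamber_sum_pos[OF w(2)] by simp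
  then show thesis using that[OF w(1) HOL.refl w(2) _ z c g \<tau>] by blast
qed

lemma develop_sum_pos: "v \<in> cone \<Longrightarrow> 0 < (\<Sum>l\<in>S. develop v l)"
  using develop_gaps gaps_total by metis

lemma config_circle: "config y \<in> PiE {1..<n} (\<lambda>_. circle)"
  by (auto simp: config_def p norm_mult)

lemma mono_gaps:
  assumes g: "gaps L z y" and y: "\<And>s. s \<in> S \<Longrightarrow> 0 \<le> y s" and "i \<le> j"
  shows "z i \<le> z j"
  using \<open>i \<le> j\<close>
proof (induction rule: int_ge_induct)
  case (step j)
  have "0 \<le> y (j mod N)" using n2 by (intro y) simp
  then show ?case using step gaps_diff[OF g, of j] by linarith
qed simp

lemma point_eqD:
  assumes "gaps L z y" "0 < L" "point L z i = point L z j"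
  obtains q where "z i = z (j + q * N)"
proof -
  have "cis (2 * pi * ((z i - z 0) / L)) = cis (2 * pi * ((z j - z 0) / L))"
    using assms(3) p by (auto simp: point_def)
  then have "exp (\<i> * of_real (2 * pi * ((z i - z 0) / L))) = exp (\<i> * of_real (2 * pi * ((z j - z 0) / L)))"
    by (simp add: cis_conv_exp)
  then obtain q :: int where "\<i> * of_real (2 * pi * ((z i - z 0) / L)) =
      \<i> * of_real (2 * pi * ((z j - z 0) / L)) + of_int (2 * q) * pi * \<i>"
    unfolding exp_eq by blast
  then have "2 * pi * ((z i - z 0) / L) = 2 * pi * ((z j - z 0) / L) + 2 * q * pi"
    by (simp add: complex_eq_iff)
  then have "2 * pi * ((z i - z 0) / L) = 2 * pi * ((z j - z 0) / L + q)"
    by (simp add: algebra_simps)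
  then have "(z i - z 0) / L = (z j - z 0) / L + q"
    by (rule mult_left_cancel[THEN iffD1, rotated]) simp
  then have "z i = z j + of_int q * L" using assms(2) by (simp add: field_simps)
  also have "\<dots> = z (j + q * N)"
    using quasi_periodic_int[of z L j q] assms(1) by (simp add: gaps_def)
  finally show thesis by (rule that)
qed

text \<open>Three coinciding points have lifts of equal value at three positions of the ordered
  sequence \<open>z \<circ> \<tau>\<close>. By monotonicity two consecutive gaps vanish, which the
  chamber excludes.\<close>

lemma config_develop_in_Q:
  assumes v: "v \<in> cone" shows "config (develop v) \<in> topspace (Q_space n p)"
proof -
  obtain w \<tau> c z L where c: "c \<in> chamber" "0 < L" and g: "gaps L z (develop v)" "gaps L (z \<circ> \<tau>) c"
    and \<tau>: "bij \<tau>" "\<And>i. \<tau> (i + N) = \<tau> i + N"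
    using develop_gaps[OF v] by metis
  have "no_triple (coord (config (develop v))) 0"
  proof (rule ccontr)
    assume "\<not> ?thesis"
    then obtain i j k where ijk: "i \<in> S" "j \<in> S" "k \<in> S" "i \<noteq> j" "j \<noteq> k" "i \<noteq> k"
      and "coord (config (develop v)) i = coord (config (develop v)) j"
        "coord (config (develop v)) j = coord (config (develop v)) k"
      unfolding no_triple_def by (auto simp: not_less)
    then have eq: "point L z i = point L z j" "point L z i = point L z k"
      using coord_config[OF g(1)] by auto
    let ?P = "\<lambda>a. z (\<tau> a) = z i"
    have ex: "\<exists>a. ?P a \<and> \<tau> a mod N = j" if j: "j \<in> S" and pj: "point L z i = point L z j" for j
    proof -
      obtain q where "z i = z (j + q * N)" by (rule point_eqD[OF g(1) c(2) pj])
      moreover obtain a where "\<tau> a = j + q * N" using \<tau>(1) by (metis bij_pointE)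
      moreover have "(j + q * N) mod N = j" using j by simp
      ultimately show ?thesis by metis
    qed
    obtain a where a: "?P a" "\<tau> a mod N = i" using ex[OF ijk(1)] by auto
    obtain b where b: "?P b" "\<tau> b mod N = j" using ex[OF ijk(2) eq(1)] by auto
    obtain d where d: "?P d" "\<tau> d mod N = k" using ex[OF ijk(3) eq(2)] by auto
    have "a \<noteq> b" "b \<noteq> d" "a \<noteq> d" using a b d ijk by auto
    then obtain l m h where lmh: "l < m" "m < h" "?P l" "?P m" "?P h"
      using a(1) b(1) d(1) by (rule sort_three)
    have cn: "0 \<le> c s" if "s \<in> S" for s using c(1) that by (simp add: chamber_def)
    have "z (\<tau> l) \<le> z (\<tau> (l + 1))" "z (\<tau> (l + 1)) \<le> z (\<tau> (l + 2))" "z (\<tau> (l + 2)) \<le> z (\<tau> h)"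
      using mono_gaps[OF g(2) cn, of l "l + 1"] mono_gaps[OF g(2) cn, of "l + 1" "l + 2"]
        mono_gaps[OF g(2) cn, of "l + 2" h] lmh by simp_all
    then have "z (\<tau> (l + 1)) - z (\<tau> l) = 0" "z (\<tau> (l + 2)) - z (\<tau> (l + 1)) = 0" using lmh by auto
    then have "c (l mod N) = 0" "c ((l + 1) mod N) = 0"
      using gaps_diff[OF g(2), of l] gaps_diff[OF g(2), of "l + 1"] by (simp_all add: add.assoc)
    moreover have "weight (l mod N) ((l mod N + 1) mod N) \<noteq> 0" using n2 by (intro weight_succ) simp
    ultimately show False using c(1) unfolding chamber_def by (auto simp: mod_add_left_eq) fastforce
  qed
  then show ?thesis using config_circle by (simp add: topspace_Q_space)
qed

section \<open>Quantitative absence of triple collisions\<close>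

lemma no_triple_margin:
  assumes "no_triple X 0" obtains \<epsilon> where "0 < \<epsilon>" "no_triple X \<epsilon>"
proof
  define A where "A = {(i, j, k) \<in> S \<times> S \<times> S. i \<noteq> j \<and> j \<noteq> k \<and> i \<noteq> k}"
  define f where "f = (\<lambda>(i, j, k). max (norm (X i - X j)) (norm (X j - X k)))"
  have finA: "finite A" by (rule finite_subset[of _ "S \<times> S \<times> S"]) (auto simp: A_def)
  have f_pos: "0 < f a" if "a \<in> A" for a
  proof -
    obtain i j k where a: "a = (i, j, k)" by (cases a)
    then have "0 < norm (X i - X j) \<or> 0 < norm (X j - X k)"
      using that assms unfolding A_def no_triple_def by blast
    then show ?thesis by (simp add: a f_def less_max_iff_disj)
  qed
  \<comment> \<open>There are no triples when n = 2, and the 1 keeps the set nonempty. Halving makes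
    the inequalities strict.\<close>
  define \<epsilon> where "\<epsilon> = Min (insert 1 (f ` A)) / 2"
  have M: "0 < Min (insert 1 (f ` A))" using finA f_pos by (subst Min_gr_iff) auto
  then show "0 < \<epsilon>" by (simp add: \<epsilon>_def)
  have "\<epsilon> < f a" if "a \<in> A" for a
  proof -
    have "Min (insert 1 (f ` A)) \<le> f a" using finA that by (intro Min_le) auto
    then show ?thesis using M by (simp add: \<epsilon>_def)
  qed
  then have "\<epsilon> < f (i, j, k)" if "i \<in> S" "j \<in> S" "k \<in> S" "i \<noteq> j" "j \<noteq> k" "i \<noteq> k" for i j k
    using that by (auto simp: A_def)
  then show "no_triple X \<epsilon>" unfolding no_triple_def f_def by (simp add: less_max_iff_disj)
qed

lemma no_triple_perturb:
  assumes X: "no_triple X d" and close: "\<And>i. i \<in> S \<Longrightarrow> norm (X i - Y i) \<le> r" and d: "d' + 2 * r \<le> d"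
  shows "no_triple Y d'"
proof -
  have bound: "norm (X i - X j) \<le> norm (Y i - Y j) + 2 * r" if "i \<in> S" "j \<in> S" for i j
  proof -
    have "X i - X j = (X i - Y i) + (Y i - Y j) - (X j - Y j)" by simp
    then have "norm (X i - X j) \<le> norm (X i - Y i) + norm (Y i - Y j) + norm (X j - Y j)"
      using norm_triangle_ineq4[of "(X i - Y i) + (Y i - Y j)" "X j - Y j"]
        norm_triangle_ineq[of "X i - Y i" "Y i - Y j"] by simp
    then show ?thesis using close[OF that(1)] close[OF that(2)] by linarith
  qed
  show ?thesis
    unfolding no_triple_def
  proof (intro ballI impI)
    fix i j k assume ijk: "i \<in> S" "j \<in> S" "k \<in> S" "i \<noteq> j" "j \<noteq> k" "i \<noteq> k"
    then have "d < norm (X i - X j) \<or> d < norm (X j - X k)" using X unfolding no_triple_def by blast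
    then show "d' < norm (Y i - Y j) \<or> d' < norm (Y j - Y k)"
      using bound[OF ijk(1,2)] bound[OF ijk(2,3)] d by linarith
  qed
qed

lemma point_dist: "norm (point 1 z i - point 1 z j) \<le> 2 * pi * \<bar>z i - z j\<bar>"
proof -
  have "point 1 z i - point 1 z j = p * (cis (2 * pi * (z i - z 0)) - cis (2 * pi * (z j - z 0)))"
    by (simp add: point_def algebra_simps)
  then have "norm (point 1 z i - point 1 z j) \<le> \<bar>2 * pi * (z i - z 0) - 2 * pi * (z j - z 0)\<bar>"
    using cis_dist[of "2 * pi * (z i - z 0)" "2 * pi * (z j - z 0)"] by (simp add: norm_mult p)
  also have "2 * pi * (z i - z 0) - 2 * pi * (z j - z 0) = 2 * pi * (z i - z j)"
    by (simp add: algebra_simps)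
  also have "\<bar>2 * pi * (z i - z j)\<bar> = 2 * pi * \<bar>z i - z j\<bar>" by (simp add: abs_mult)
  finally show ?thesis .
qed

text \<open>Two consecutive short gaps in the ordered lift put three points with different labels
  close together; the factor \<open>2 * pi\<close> converts length into arc length.\<close>

lemma consecutive_gaps_large:
  assumes g: "gaps 1 z y" and \<tau>: "bij \<tau>" "\<And>i. \<tau> (i + N) = \<tau> i + N" and c: "gaps 1 (z \<circ> \<tau>) c"
    and nt: "no_triple (point 1 z) (2 * pi * \<delta>)" and \<delta>: "\<delta> < 1 / 2"
    and s: "s \<in> S" "\<bar>c s\<bar> \<le> \<delta>" "\<bar>c ((s + 1) mod N)\<bar> \<le> \<delta>"
  shows False
proof (cases "n = 2")
  case True
  \<comment> \<open>With two points \<open>nt\<close> is vacuous, but the two gaps add up to 1 and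
    cannot both be below 1/2. This is the origin of the bound on \<open>\<delta>\<close>.\<close>
  have "S = {0, 1}" using True by auto
  then have "c 0 + c 1 = 1" using gaps_total[OF c] by simp
  moreover have "s = 0 \<or> s = 1" using s(1) True by auto
  then have "s = 0 \<and> (s + 1) mod N = 1 \<or> s = 1 \<and> (s + 1) mod N = 0" using True by auto
  ultimately show False using s \<delta> by auto
next
  case False
  then have n3: "3 \<le> N" using n2 by simp
  have smod: "s mod N = s" using s by simp
  have ne: "(s + a) mod N \<noteq> (s + b) mod N" if "0 \<le> a" "a < b" "b \<le> 2" for a b
  proof
    assume "(s + a) mod N = (s + b) mod N"
    then have "N dvd (b - a)" using mod_eq_dvd_iff[of "s + b" N "s + a"] by simp
    then show False using zdvd_imp_le[of N "b - a"] n3 that by simp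
  qed
  let ?i = "\<lambda>a. \<tau> (s + a) mod N"
  have dist: "?i 0 \<noteq> ?i 1" "?i 1 \<noteq> ?i 2" "?i 0 \<noteq> ?i 2"
    using ne[of 0 1] ne[of 1 2] ne[of 0 2] by (simp_all add: bij_periodic_mod[OF \<tau>])
  have step: "norm (point 1 z (?i a) - point 1 z (?i (a + 1))) \<le> 2 * pi * \<delta>"
    if "\<bar>c ((s + a) mod N)\<bar> \<le> \<delta>" for a
  proof -
    have "norm (point 1 z (?i a) - point 1 z (?i (a + 1))) \<le> 2 * pi * \<bar>z (\<tau> (s + a)) - z (\<tau> (s + (a + 1)))\<bar>"
      using point_dist by (simp add: point_mod[OF g])
    also have "\<bar>z (\<tau> (s + a)) - z (\<tau> (s + (a + 1)))\<bar> = \<bar>c ((s + a) mod N)\<bar>"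
      using gaps_diff[OF c, of "s + a"] by (simp add: add.assoc)
    also have "2 * pi * \<dots> \<le> 2 * pi * \<delta>" using that by (intro mult_left_mono) auto
    finally show ?thesis .
  qed
  have "?i a \<in> S" for a using n2 by simp
  then have "2 * pi * \<delta> < norm (point 1 z (?i 0) - point 1 z (?i 1)) \<or>
      2 * pi * \<delta> < norm (point 1 z (?i 1) - point 1 z (?i 2))"
    using nt dist unfolding no_triple_def by blast
  then show False using step[of 0] step[of 1] s smod by auto
qed

lemma adjacent_gaps_large:
  assumes g: "gaps 1 z y" and \<tau>: "bij \<tau>" "\<And>i. \<tau> (i + N) = \<tau> i + N" and c: "gaps 1 (z \<circ> \<tau>) c"
    and nt: "no_triple (point 1 z) (2 * pi * \<delta>)" and \<delta>: "\<delta> < 1 / 2"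
    and st: "weight s t \<noteq> 0" "\<bar>c s\<bar> \<le> \<delta>"
  shows "\<delta> < \<bar>c t\<bar>"
proof (rule ccontr)
  assume "\<not> \<delta> < \<bar>c t\<bar>"
  moreover have "s \<in> S" "t \<in> S" "t = (s + 1) mod N \<or> s = (t + 1) mod N"
    using st(1) by (auto simp: weight_def split: if_splits)
  ultimately show False using consecutive_gaps_large[OF g \<tau> c nt \<delta>] st(2) by force
qed

section \<open>The covering of the configuration space\<close>

definition slice :: "(int \<Rightarrow> real) set" where
  "slice = {v \<in> cone. (\<Sum>l\<in>S. develop v l) = 1}"

text \<open>It is kept on the whole cone, through which the contraction passes; its restriction to
  \<open>slice\<close> is the covering.\<close>

definition proj :: "(int \<Rightarrow> real) \<Rightarrow> nat \<Rightarrow> complex" where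
  "proj v = config (develop v)"

lemma continuous_map_proj: "continuous_map (top_of_set cone) (Q_space n p) proj"
proof -
  have dev [continuous_intros]: "continuous_on cone (\<lambda>v. develop v l)" for l
    by (rule continuous_on_product_then_coordinatewise[OF continuous_develop])
  have "continuous_on cone (\<lambda>v. proj v j)" if "j \<in> {1..<n}" for j
  proof -
    have "continuous_on cone (\<lambda>v. p * cis (2 * pi * ((\<Sum>l\<in>{0..<int j}. develop v l) / (\<Sum>l\<in>S. develop v l))))"
      by (intro continuous_intros) (use develop_sum_pos in force)
    then show ?thesis using that by (simp add: proj_def config_def)
  qed
  moreover have "proj v j \<in> circle" if "j \<in> {1..<n}" for v j
    using config_circle[of "develop v"] that unfolding proj_def by blast
  ultimately have "continuous_map (top_of_set cone) (torus n) proj"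
    unfolding torus_def continuous_map_componentwise
    by (auto simp: continuous_map_in_subtopology proj_def config_def)
  moreover have "proj v \<in> topspace (torus n) - triple_diagonals n p" if "v \<in> cone" for v
    using config_develop_in_Q[OF that] by (simp add: proj_def Q_space_def)
  ultimately show ?thesis unfolding Q_space_def by (intro continuous_map_into_subtopology) auto
qed

lemma continuous_map_coord:
  assumes "j \<in> S" shows "continuous_map (Q_space n p) euclidean (\<lambda>x. coord x j)"
proof (cases "j = 0")
  case False
  then have "nat j \<in> {1..<n}" using assms by auto
  then have "continuous_map (torus n) (top_of_set circle) (\<lambda>x. x (nat j))"
    unfolding torus_def by (rule continuous_map_product_projection)
  then have "continuous_map (torus n) euclidean (\<lambda>x. x (nat j))"
    using continuous_map_into_fulltopology by blast
  then show ?thesis using False unfolding Q_space_def coord_def by (simp add: continuous_map_from_subtopology)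
qed (simp add: coord_def)

text \<open>Equal configurations of length 1 have lifts whose differences agree up to integers, and
  closeness excludes nonzero integers. The developed vectors are then equal, and the chart
  \<open>phi T\<close> is injective.\<close>

lemma proj_locally_injective:
  assumes e: "e \<in> slice"
  shows "\<exists>M. openin (top_of_set slice) M \<and> e \<in> M \<and> inj_on proj M"
proof -
  have ec: "e \<in> cone" using e by (simp add: slice_def)
  obtain w T where star: "fold (refl 2) w e \<in> star T"
    and eq: "\<And>x. x \<in> cone \<Longrightarrow> fold (refl 2) w x \<in> star T \<Longrightarrow> fold (refl 1) w (develop x) = phi T (fold (refl 2) w x)"
    using cone_chart[OF ec] by metis
  \<comment> \<open>Gaps of two vectors in \<open>B\<close> differ by less than
    \<open>1 / (2 * n)\<close>, so their partial sums differ by at most 1/2, which is less than a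
    full turn.\<close>
  define B where "B = (\<Inter>s\<in>S. {y. \<bar>y s - develop e s\<bar> < 1 / (4 * n)})"
  have "open B"
  proof -
    have "open {y. \<bar>y s - develop e s\<bar> < 1 / (4 * n)}" for s
      by (intro open_Collect_less) (auto intro!: continuous_intros intro: continuous_on_product_then_coordinatewise)
    then show ?thesis unfolding B_def by (intro open_INT) auto
  qed
  define M where "M = slice \<inter> (\<lambda>x. fold (refl 2) w x) -` star T \<inter> (slice \<inter> develop -` B)"
  have "open ((\<lambda>x. fold (refl 2) w x) -` star T)"
    by (intro open_vimage open_star continuous_intros continuous_on_id)
  moreover have "continuous_on slice develop"
    by (rule continuous_on_subset[OF continuous_develop]) (auto simp: slice_def)
  ultimately have "openin (top_of_set slice) M"
    unfolding M_def using \<open>open B\<close>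
    by (intro openin_Int openin_open_Int continuous_openin_preimage_gen)
  moreover have "e \<in> M" using e star n2 by (auto simp: M_def B_def)
  moreover have "inj_on proj M"
  proof (rule inj_onI)
    fix u v assume u: "u \<in> M" and v: "v \<in> M" and uv: "proj u = proj v"
    have uc: "u \<in> cone" "v \<in> cone" using u v by (auto simp: M_def slice_def)
    obtain a where a: "gaps 1 a (develop u)"
      using gaps_exist[of "develop u"] develop_outside[OF uc(1)] u by (auto simp: M_def slice_def)
    obtain b where b: "gaps 1 b (develop v)"
      using gaps_exist[of "develop v"] develop_outside[OF uc(2)] v by (auto simp: M_def slice_def)
    have close: "\<bar>(a i - a 0) - (b i - b 0)\<bar> \<le> 1 / 2" if i: "i \<in> S" for i
    proof -
      have "(a i - a 0) - (b i - b 0) = (\<Sum>l\<in>{0..<i}. develop u l - develop v l)"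
        using gaps_sum[OF a, of "nat i"] gaps_sum[OF b, of "nat i"] i by (simp add: sum_subtractf nat_le_iff)
      also have "\<bar>\<dots>\<bar> \<le> (\<Sum>l\<in>{0..<i}. 1 / (2 * n))"
      proof (rule order_trans[OF sum_abs], rule sum_mono)
        fix l assume "l \<in> {0..<i}"
        then have "l \<in> S" using i by auto
        then have "\<bar>develop u l - develop e l\<bar> < 1 / (4 * n)" "\<bar>develop v l - develop e l\<bar> < 1 / (4 * n)"
          using u v by (auto simp: M_def B_def)
        then have "\<bar>develop u l - develop v l\<bar> \<le> 1 / (4 * n) + 1 / (4 * n)" by linarith
        then show "\<bar>develop u l - develop v l\<bar> \<le> 1 / (2 * n)" by simp
      qed
      also have "\<dots> = i / (2 * n)" using i by simp
      also have "\<dots> \<le> 1 / 2" using i n2 by (simp add: field_simps)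
      finally show ?thesis .
    qed
    have S_eq: "a i - a 0 = b i - b 0" if i: "i \<in> S" for i
    proof -
      have "point 1 a i = point 1 b i"
        using coord_config[OF a i] coord_config[OF b i] uv by (simp add: proj_def)
      then have "cis (2 * pi * (a i - a 0)) = cis (2 * pi * (b i - b 0))" using p by (auto simp: point_def)
      then have "exp (\<i> * of_real (2 * pi * (a i - a 0))) = exp (\<i> * of_real (2 * pi * (b i - b 0)))"
        by (simp add: cis_conv_exp)
      then have "\<i> * of_real (2 * pi * (a i - a 0)) = \<i> * of_real (2 * pi * (b i - b 0))"
      proof (rule exp_complex_eqI[rotated])
        have "\<bar>2 * pi * (a i - a 0) - 2 * pi * (b i - b 0)\<bar> = 2 * pi * \<bar>(a i - a 0) - (b i - b 0)\<bar>"
          by (simp add: abs_mult flip: right_diff_distrib)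
        also have "\<dots> \<le> 2 * pi * (1 / 2)" using close[OF i] by (intro mult_left_mono) auto
        also have "\<dots> < 2 * pi" by simp
        finally show "\<bar>Im (\<i> * of_real (2 * pi * (a i - a 0))) - Im (\<i> * of_real (2 * pi * (b i - b 0)))\<bar> < 2 * pi"
          by simp
      qed
      then have "complex_of_real (2 * pi * (a i - a 0)) = complex_of_real (2 * pi * (b i - b 0))"
        by (simp only: mult_left_cancel[OF complex_i_not_zero])
      then have "2 * pi * (a i - a 0) = 2 * pi * (b i - b 0)" by (simp only: of_real_eq_iff)
      then show ?thesis by (rule mult_left_cancel[THEN iffD1, rotated]) simp
    qed
    have "develop u s = develop v s" for s
    proof (cases "s \<in> S")
      case True
      have "a (s + 1) - a 0 = b (s + 1) - b 0"
      proof (cases "s + 1 = N")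
        case True
        moreover have "a (0 + N) = a 0 + 1" "b (0 + N) = b 0 + 1" using a b unfolding gaps_def by blast+
        ultimately show ?thesis by simp
      next
        case False
        then show ?thesis using S_eq[of "s + 1"] \<open>s \<in> S\<close> by simp
      qed
      then show ?thesis using True S_eq[OF True] a b by (simp add: gaps_def)
    next
      case False
      then show ?thesis using develop_outside uc by simp
    qed
    then have "develop u = develop v" by auto
    then have "phi T (fold (refl 2) w u) = phi T (fold (refl 2) w v)"
      using eq[OF uc(1)] eq[OF uc(2)] u v by (simp add: M_def)
    then have "fold (refl 2) w u = fold (refl 2) w v" by (metis psi_phi)
    then show "u = v" by (metis fold_refl_rev)
  qed
  ultimately show ?thesis by blast
qed

text \<open>Bubble sort: the exchange at a descent removes an inversion. Choosing the lift in a
  single period reduces the affine sorting problem to a finite one.\<close>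

lemma sort_gaps:
  assumes "gaps 1 z y" and "\<And>j. j \<in> S \<Longrightarrow> 0 \<le> z j \<and> z j < 1"
  shows "\<exists>w. set w \<subseteq> S \<and> (\<forall>s\<in>S. 0 \<le> fold (refl 1) w y s)"
  using assms
proof (induction "card {(i, j). i \<in> S \<and> j \<in> S \<and> i < j \<and> z j < z i}" arbitrary: z y rule: less_induct)
  case less
  show ?case
  proof (cases "\<forall>s\<in>S. 0 \<le> y s")
    case True
    then show ?thesis by (intro exI[of _ "[]"]) auto
  next
    case False
    then obtain s where s: "s \<in> S" "y s < 0" by (auto simp: not_le)
    have desc: "z (s + 1) < z s" using s less.prems(1) by (simp add: gaps_def)
    \<comment> \<open>An exchange across the seam would leave the period; none occurs, because
      \<open>z N = z 0 + 1\<close> exceeds \<open>z (N - 1)\<close>.\<close>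
    have "s \<noteq> N - 1"
    proof
      assume "s = N - 1"
      moreover have "z (0 + N) = z 0 + 1" using less.prems(1) unfolding gaps_def by blast
      ultimately have "z (s + 1) = z 0 + 1" by simp
      then show False using desc less.prems(2)[of 0] less.prems(2)[of s] s n2 by auto
    qed
    then have s1: "s + 1 \<in> S" "(s + 1) mod N = s + 1" using s by auto
    have sw: "swap s i = (if i = s then s + 1 else if i = s + 1 then s else i)" if "i \<in> S" for i
      using that s1 by (simp add: swap_def)
    have swS: "swap s i \<in> S" if "i \<in> S" for i using sw[OF that] that s s1 by auto
    let ?inv = "\<lambda>z. {(i, j). i \<in> S \<and> j \<in> S \<and> i < j \<and> z j < (z i :: real)}"
    have fin_inv: "finite (?inv z)" by (rule finite_subset[of _ "S \<times> S"]) auto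
    have "card (?inv (z \<circ> swap s)) \<le> card (?inv z - {(s, s + 1)})"
    proof (rule card_inj_on_le)
      show "inj_on (map_prod (swap s) (swap s)) (?inv (z \<circ> swap s))"
        by (rule inj_on_inverseI[of _ "map_prod (swap s) (swap s)"]) (auto simp: swap_swap[OF s(1)])
      show "map_prod (swap s) (swap s) ` ?inv (z \<circ> swap s) \<subseteq> ?inv z - {(s, s + 1)}"
      proof (rule image_subsetI, clarify)
        fix i j assume ij: "i \<in> S" "j \<in> S" "i < j" "(z \<circ> swap s) j < (z \<circ> swap s) i"
        have "swap s i < swap s j"
          using sw[OF ij(1)] sw[OF ij(2)] ij(3,4) desc by (auto split: if_splits)
        moreover have "\<not> (swap s i = s \<and> swap s j = s + 1)"
          using sw[OF ij(1)] sw[OF ij(2)] ij(3) by (auto split: if_splits)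
        ultimately show "map_prod (swap s) (swap s) (i, j) \<in> ?inv z - {(s, s + 1)}"
          using ij swS[OF ij(1)] swS[OF ij(2)] by simp
      qed
    qed (use fin_inv in simp)
    also have "\<dots> < card (?inv z)"
      using s(1) s1(1) desc by (intro card_Diff1_less fin_inv) simp
    finally have lt: "card (?inv (z \<circ> swap s)) < card (?inv z)" .
    have "0 \<le> (z \<circ> swap s) j \<and> (z \<circ> swap s) j < 1" if "j \<in> S" for j
      using less.prems(2)[OF swS[OF that]] by simp
    then obtain w where "set w \<subseteq> S" "\<forall>t\<in>S. 0 \<le> fold (refl 1) w (refl 1 s y) t"
      using less.hyps[OF lt gaps_swap[OF less.prems(1) s(1)]] by blast
    then show ?thesis using s by (intro exI[of _ "s # w"]) simp
  qed
qed

lemma proj_surj: "proj ` slice = topspace (Q_space n p)"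
proof
  show "proj ` slice \<subseteq> topspace (Q_space n p)"
    using config_develop_in_Q by (auto simp: slice_def proj_def)
  show "topspace (Q_space n p) \<subseteq> proj ` slice"
  proof
    fix x assume x: "x \<in> topspace (Q_space n p)"
    define A where "A j = Arg2pi (coord x j / p) / (2 * pi)" for j
    have p0: "p \<noteq> 0" using p by auto
    have A01: "0 \<le> A j \<and> A j < 1" for j
      using Arg2pi[of "coord x j / p"] by (simp add: A_def)
    have A: "p * cis (2 * pi * A j) = coord x j" if "j \<in> S" for j
    proof -
      have "norm (coord x j / p) = 1" using norm_coord[OF x that] p by (simp add: norm_divide)
      then have "coord x j / p = cis (2 * pi * A j)"
        using Arg2pi_eq[of "coord x j / p"] by (simp add: A_def cis_conv_exp)
      then show ?thesis using p0 by (simp add: field_simps)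
    qed
    have A0: "A 0 = 0" using p0 Arg2pi_unique[of 1 0 1] by (simp add: A_def coord_def)
    define z where "z i = A (i mod N) + of_int (i div N)" for i
    define y where "y s = (if s \<in> S then z (s + 1) - z s else 0)" for s
    have zS: "z j = A j" if "j \<in> S" for j using that by (simp add: z_def)
    have g: "gaps 1 z y" unfolding gaps_def y_def using n2 by (simp add: z_def)
    have pt: "point 1 z j = coord x j" if "j \<in> S" for j
      using A[OF that] zS[OF that] zS[of 0] A0 n2 by (simp add: point_def)
    obtain w where w: "set w \<subseteq> S" "\<forall>s\<in>S. 0 \<le> fold (refl 1) w y s"
      using sort_gaps[OF g] zS A01 by auto
    obtain \<tau> where \<tau>: "bij \<tau>" "\<And>i. \<tau> (i + N) = \<tau> i + N"
      and g': "gaps 1 (z \<circ> \<tau>) (fold (refl 1) w y)" using gaps_fold[OF w(1)] g by metis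
    define c where "c = fold (refl 1) w y"
    \<comment> \<open>The margin is written as a multiple of \<open>2 * pi\<close> so that
      \<open>adjacent_gaps_large\<close> applies with \<open>\<delta> = 0\<close>.\<close>
    have nt: "no_triple (point 1 z) (2 * pi * 0)"
      using x pt unfolding topspace_Q_space no_triple_def by simp
    have "c \<in> chamber"
      unfolding chamber_def
    proof (intro CollectI conjI allI impI ballI)
      show "c i = 0" if "i \<notin> S" for i using g' that unfolding c_def gaps_def by presburger
      show "0 \<le> c s" if "s \<in> S" for s using w(2) that by (simp add: c_def)
      fix s t assume st: "weight s t \<noteq> 0"
      then have "0 \<le> c s" "0 \<le> c t" using w(2) supp supp2 by (auto simp: c_def)
      then show "0 < c s \<or> 0 < c t"
        using adjacent_gaps_large[OF g \<tau> g' nt _ st] by (cases "c s = 0") (auto simp: c_def)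
    qed
    then have cc: "c \<in> cone" "develop c = c" using chamber_iff develop_chamber by auto
    \<comment> \<open>The sorting was done with \<open>refl 1\<close>; undoing the same word with
      \<open>refl 2\<close> gives a vector of the cone that develops back to
      \<open>y\<close>.\<close>
    define v where "v = fold (refl 2) (rev w) c"
    have "v \<in> cone" using cone_fold[OF cc(1)] w(1) by (simp add: v_def)
    have "develop v = fold (refl 1) (rev w) c"
      using develop_fold[OF cc(1), of "rev w"] w(1) cc(2) by (simp add: v_def)
    then have dv: "develop v = y" unfolding c_def by (simp add: fold_refl_rev)
    have "v \<in> slice" using \<open>v \<in> cone\<close> gaps_total[OF g] by (simp add: slice_def dv)
    moreover have "config y = x"
    proof
      fix j
      show "config y j = x j"
      proof (cases "j \<in> {1..<n}")
        case True
        then have "int j \<in> S" "int j \<noteq> 0" by auto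
        then show ?thesis using coord_config[OF g, of "int j"] pt[of "int j"] by (simp add: coord_def)
      next
        case False
        then show ?thesis using x by (auto simp: config_def topspace_Q_space PiE_iff extensional_def)
      qed
    qed
    ultimately show "x \<in> proj ` slice" by (metis dv imageI proj_def)
  qed
qed

text \<open>
  The neighbourhood \<open>V\<close> must not depend on the point \<open>e\<close> of the fibre. Folding \<open>e\<close> into the
  chamber, the gaps of size less than \<open>\<delta>\<close> are pairwise non-adjacent since no three points of the
  configuration are close, and the gaps of a configuration in \<open>V\<close>, in the same order, are
  close to those of \<open>e\<close>; on them the inverse \<open>psi T\<close> of the developing map is available.
\<close>

lemma proj_sections:
  assumes x0: "x0 \<in> topspace (Q_space n p)"
  shows "\<exists>V. openin (Q_space n p) V \<and> x0 \<in> V \<and> (\<forall>e\<in>slice. proj e \<in> V \<longrightarrow>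
    (\<exists>\<sigma>. continuous_map (subtopology (Q_space n p) V) (top_of_set slice) \<sigma> \<and>
      (\<forall>x\<in>V. proj (\<sigma> x) = x) \<and> \<sigma> (proj e) = e))"
proof -
  let ?Q = "Q_space n p"
  have "no_triple (coord x0) 0" using x0 by (simp add: topspace_Q_space)
  then obtain \<epsilon> where \<epsilon>: "0 < \<epsilon>" "no_triple (coord x0) \<epsilon>" by (rule no_triple_margin)
  \<comment> \<open>Half of the margin \<open>\<epsilon>\<close> is reserved for
    \<open>2 * pi * \<delta>\<close>, and 1/4 keeps \<open>\<delta>\<close> below the bound 1/2 of
    \<open>adjacent_gaps_large\<close>.\<close>
  define \<delta> where "\<delta> = min (\<epsilon> / (4 * pi)) (1 / 4)"
  have \<delta>: "0 < \<delta>" "\<delta> < 1 / 2" using \<epsilon> by (auto simp: \<delta>_def)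
  have \<delta>\<epsilon>: "2 * pi * \<delta> \<le> \<epsilon> / 2"
  proof -
    have "2 * pi * \<delta> \<le> 2 * pi * (\<epsilon> / (4 * pi))" by (intro mult_left_mono) (auto simp: \<delta>_def)
    then show ?thesis by simp
  qed
  \<comment> \<open>Angles will move by at most \<open>\<eta>\<close> and gaps by
    \<open>2 * \<eta>\<close>. At most \<open>n\<close> terms of weight at most 2 cost
    \<open>4 * n * \<eta>\<close> more, and the total \<open>(4 * n + 2) * \<eta>\<close> has to
    stay below \<open>\<delta>\<close>.\<close>
  define \<eta> where "\<eta> = \<delta> / (4 * n + 4)"
  have \<eta>: "0 < \<eta>" "(4 * n + 4) * \<eta> = \<delta>" using \<delta> by (auto simp: \<eta>_def)
  have "isCont Arg 1" by (rule continuous_at_Arg) simp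
  then obtain r where r: "0 < r" "\<And>u. norm (u - 1) < r \<Longrightarrow> \<bar>Arg u\<bar> < 2 * pi * \<eta>"
    using \<eta> unfolding continuous_at_eps_delta by (metis Arg_1 dist_norm dist_real_def diff_zero mult_pos_pos pi_gt_zero zero_less_numeral)
  \<comment> \<open>The first bound spends the other half of \<open>\<epsilon>\<close>, as a
    perturbation by \<open>\<rho>\<close> costs \<open>2 * \<rho>\<close>. The second puts quotients
    of corresponding points of two configurations in \<open>V\<close> within \<open>r\<close> of 1,
    and the third keeps these quotients in the right half plane, where \<open>Arg\<close> is
    continuous.\<close>
  define \<rho> where "\<rho> = min (\<epsilon> / 4) (min (r / 2) (1 / 2))"
  have \<rho>: "0 < \<rho>" "\<rho> \<le> \<epsilon> / 4" "2 * \<rho> \<le> r" "2 * \<rho> \<le> 1" using \<epsilon> r by (auto simp: \<rho>_def)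
  define V where "V = (\<Inter>j\<in>S. {x \<in> topspace ?Q. coord x j \<in> ball (coord x0 j) \<rho>}) \<inter> topspace ?Q"
  have V: "x \<in> V \<longleftrightarrow> x \<in> topspace ?Q \<and> (\<forall>j\<in>S. norm (coord x0 j - coord x j) < \<rho>)" for x
    using n2 by (auto simp: V_def dist_norm)
  have "openin ?Q V"
    unfolding V_def
    by (intro openin_INT openin_continuous_map_preimage[OF continuous_map_coord]) auto
  moreover have "x0 \<in> V" using x0 \<rho> by (simp add: V)
  moreover have "\<exists>\<sigma>. continuous_map (subtopology ?Q V) (top_of_set slice) \<sigma> \<and>
      (\<forall>x\<in>V. proj (\<sigma> x) = x) \<and> \<sigma> (proj e) = e" if e: "e \<in> slice" and eV: "proj e \<in> V" for e
  proof -
    define x1 where "x1 = proj e"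
    define y1 where "y1 = develop e"
    have ec: "e \<in> cone" using e by (simp add: slice_def)
    have x1: "x1 \<in> topspace ?Q" "x1 \<in> V" using eV by (auto simp: x1_def V)
    obtain w \<tau> c z L where w: "set w \<subseteq> S" "fold (refl 2) w e = c" and c: "c \<in> chamber"
      and gL: "gaps L z y1" and wc: "fold (refl 1) w y1 = c" and cL: "gaps L (z \<circ> \<tau>) c"
      and \<tau>: "bij \<tau>" "\<And>i. \<tau> (i + N) = \<tau> i + N"
      and fw: "\<And>L z y. gaps L z y \<Longrightarrow> gaps L (z \<circ> \<tau>) (fold (refl 1) w y)"
      using develop_gaps[OF ec] unfolding y1_def by metis
    have "L = 1" using gaps_total[OF gL] e by (simp add: slice_def y1_def)
    then have g: "gaps 1 z y1" and cg: "gaps 1 (z \<circ> \<tau>) c" using gL cL by auto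
    have pt: "point 1 z j = coord x1 j" if "j \<in> S" for j
      using coord_config[OF g that] by (simp add: x1_def proj_def y1_def)
    have nt: "no_triple (point 1 z) (2 * pi * \<delta>)"
    proof (rule no_triple_perturb[OF \<epsilon>(2)])
      show "norm (coord x0 i - point 1 z i) \<le> \<rho>" if "i \<in> S" for i
        using x1(2) that pt by (auto simp: V less_imp_le)
    qed (use \<delta>\<epsilon> \<rho> in linarith)
    define T where "T = {s \<in> S. c s < \<delta>}"
    have cS: "0 \<le> c s" if "s \<in> S" for s using c that by (simp add: chamber_def)
    have T: "weight s t = 0" if "s \<in> T" "t \<in> T" for s t
    proof (rule ccontr)
      assume st: "weight s t \<noteq> 0"
      have "\<bar>c s\<bar> \<le> \<delta>" "\<bar>c t\<bar> < \<delta>" using that cS by (auto simp: T_def)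
      then show False using adjacent_gaps_large[OF g \<tau> cg nt \<delta>(2) st] by linarith
    qed
    \<comment> \<open>\<open>u x j\<close> is the rotation from the point \<open>j\<close> of
      \<open>x1\<close> to that of \<open>x\<close>, and \<open>a x j\<close> is its angle in full
      turns. Displacing the lift \<open>z\<close> of \<open>x1\<close> by these angles lifts
      \<open>x\<close>, and the word \<open>w\<close> and the permutation of \<open>e\<close> can be
      reused.\<close>
    define u where "u x j = coord x j / coord x1 j" for x j
    define a where "a x j = Arg (u x j) / (2 * pi)" for x j
    have u: "norm (u x j) = 1" "norm (u x j - 1) < 2 * \<rho>" if "x \<in> V" "j \<in> S" for x j
    proof -
      have n1: "norm (coord x j) = 1" "norm (coord x1 j) = 1"
        using norm_coord that x1 by (auto simp: V)
      then show "norm (u x j) = 1" by (simp add: u_def norm_divide)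
      have "u x j - 1 = (coord x j - coord x1 j) / coord x1 j"
        using n1 by (auto simp: u_def diff_divide_distrib)
      then have "norm (u x j - 1) = norm (coord x j - coord x1 j)" using n1 by (simp add: norm_divide)
      also have "\<dots> \<le> norm (coord x0 j - coord x1 j) + norm (coord x0 j - coord x j)"
        using norm_triangle_ineq4[of "coord x0 j - coord x1 j" "coord x0 j - coord x j"] by simp
      also have "\<dots> < 2 * \<rho>"
        using that(1) x1(2) that(2) unfolding V by (smt (verit))
      finally show "norm (u x j - 1) < 2 * \<rho>" .
    qed
    have a_small: "\<bar>a x j\<bar> < \<eta>" if "x \<in> V" "j \<in> S" for x j
      using r(2)[of "u x j"] u[OF that] \<rho> by (auto simp: a_def field_simps)
    have a0: "a x 0 = 0" for x
      using p by (auto simp: a_def u_def coord_def)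
    have cis_a: "coord x1 j * cis (2 * pi * a x j) = coord x j" if "x \<in> V" "j \<in> S" for x j
    proof -
      have "u x j \<noteq> 0" using u(1)[OF that] by auto
      then have "cis (2 * pi * a x j) = u x j"
        using cis_Arg[of "u x j"] u(1)[OF that] by (simp add: a_def sgn_div_norm)
      moreover have "coord x1 j \<noteq> 0" using norm_coord[OF x1(1) that(2)] by auto
      ultimately show ?thesis by (simp add: u_def)
    qed
    define zx where "zx x i = z i + a x (i mod N)" for x i
    define yx where "yx x s = (if s \<in> S then zx x (s + 1) - zx x s else 0)" for x s
    have gx: "gaps 1 (zx x) (yx x)" for x
      using g by (simp add: gaps_def yx_def zx_def)
    have yx_config: "config (yx x) = x" if x: "x \<in> V" for x
    proof
      fix j
      show "config (yx x) j = x j"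
      proof (cases "j \<in> {1..<n}")
        case True
        then have j: "int j \<in> S" "int j \<noteq> 0" "int j mod N = int j" by auto
        have "config (yx x) j = point 1 (zx x) (int j)"
          using coord_config[OF gx j(1), of x] j by (simp add: coord_def)
        also have "\<dots> = point 1 z (int j) * cis (2 * pi * a x (int j))"
          using j a0 by (simp add: point_def zx_def cis_mult distrib_left diff_add_eq algebra_simps)
        also have "\<dots> = coord x (int j)" using pt[OF j(1)] cis_a[OF x j(1)] by simp
        finally show ?thesis using j by (simp add: coord_def)
      next
        case False
        then show ?thesis using x by (auto simp: config_def V topspace_Q_space PiE_iff extensional_def)
      qed
    qed
    define y' where "y' x = fold (refl 1) w (yx x)" for x
    have gy': "gaps 1 (zx x \<circ> \<tau>) (y' x)" for x unfolding y'_def by (rule fw[OF gx])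
    have y'_close: "\<bar>y' x s - c s\<bar> \<le> 2 * \<eta>" if x: "x \<in> V" and s: "s \<in> S" for x s
    proof -
      have "y' x s - c s = a x (\<tau> (s + 1) mod N) - a x (\<tau> s mod N)"
        using gy' cg s by (simp add: gaps_def zx_def)
      moreover have "\<bar>a x (i mod N)\<bar> < \<eta>" for i using n2 by (intro a_small[OF x]) simp
      from this[of "\<tau> (s + 1)"] this[of "\<tau> s"]
      have "\<bar>a x (\<tau> (s + 1) mod N) - a x (\<tau> s mod N)\<bar> \<le> 2 * \<eta>" by linarith
      ultimately show ?thesis by simp
    qed
    have y'_out: "y' x i = 0" if "i \<notin> S" for x i using gy'[of x] that unfolding gaps_def by presburger
    have "T \<subseteq> S" by (auto simp: T_def)
    have star: "psi T (y' x) \<in> star T" if x: "x \<in> V" for x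
      unfolding star_def
    proof (intro CollectI ballI)
      fix s assume s: "s \<in> S - T"
      have finT: "card T \<le> n"
        using card_mono[OF _ \<open>T \<subseteq> S\<close>] by simp
      have "(\<Sum>t\<in>T. - (4 * \<eta>)) \<le> (\<Sum>t\<in>T. weight t s * min (y' x t) 0)"
      proof (rule sum_mono)
        fix t assume t: "t \<in> T"
        then have "- (2 * \<eta>) \<le> min (y' x t) 0"
          using y'_close[OF x, of t] cS[of t] \<eta>(1) by (auto simp: T_def)
        then have "weight t s * - (2 * \<eta>) \<le> weight t s * min (y' x t) 0"
          by (intro mult_left_mono weight_nonneg)
        moreover have "weight t s * (2 * \<eta>) \<le> 2 * (2 * \<eta>)"
          using weight_le \<eta>(1) by (intro mult_right_mono) auto
        ultimately show "- (4 * \<eta>) \<le> weight t s * min (y' x t) 0" by linarith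
      qed
      moreover have "card T * (4 * \<eta>) \<le> n * (4 * \<eta>)" using finT \<eta>(1) by (intro mult_right_mono) auto
      ultimately have "- (n * (4 * \<eta>)) \<le> (\<Sum>t\<in>T. weight t s * min (y' x t) 0)" by simp
      moreover have "\<delta> \<le> c s" using s by (auto simp: T_def)
      then have "\<delta> - 2 * \<eta> \<le> y' x s" using y'_close[OF x, of s] s by auto
      moreover have "2 * \<eta> + n * (4 * \<eta>) < \<delta>" using \<eta> by (simp add: algebra_simps)
      ultimately have pos: "0 < y' x s + (\<Sum>t\<in>T. weight t s * min (y' x t) 0)" by linarith
      \<comment> \<open>\<open>psi\<close> subtracts once the sum that the condition of
        \<open>star\<close> adds twice, so the quantity to be positive is the one in
        \<open>pos\<close>.\<close>
      have "(\<Sum>t\<in>T. weight t s * min (psi T (y' x) t) 0) = (\<Sum>t\<in>T. weight t s * min (y' x t) 0)"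
        by (intro sum.cong) (auto simp: psi_def)
      moreover have "psi T (y' x) s = y' x s - (\<Sum>t\<in>T. weight t s * min (y' x t) 0)"
        using s by (simp add: psi_def)
      ultimately show "0 < psi T (y' x) s + 2 * (\<Sum>t\<in>T. weight t s * min (psi T (y' x) t) 0)"
        using pos by simp
    qed
    have psi_out: "psi T (y' x) i = 0" if i: "i \<notin> S" for x i
    proof -
      have "weight t i = 0" for t using i by (auto simp: weight_def)
      then show ?thesis using y'_out[OF i] by (simp add: psi_def)
    qed
    have psi_dev: "psi T (y' x) \<in> cone" "develop (psi T (y' x)) = y' x" if x: "x \<in> V" for x
      using star_develop[OF \<open>T \<subseteq> S\<close> T star[OF x] psi_out] by auto
    define \<sigma> where "\<sigma> x = fold (refl 2) (rev w) (psi T (y' x))" for x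
    have rw: "set (rev w) \<subseteq> S" using w by simp
    have \<sigma>: "\<sigma> x \<in> cone" "develop (\<sigma> x) = yx x" if x: "x \<in> V" for x
      using cone_fold[OF psi_dev(1)[OF x] rw] develop_fold[OF psi_dev(1)[OF x] rw] psi_dev(2)[OF x]
      by (simp_all add: \<sigma>_def y'_def fold_refl_rev)
    have \<sigma>_slice: "\<sigma> x \<in> slice" if "x \<in> V" for x
      using \<sigma>[OF that] gaps_total[OF gx] by (simp add: slice_def)
    have "proj (\<sigma> x) = x" if "x \<in> V" for x
      using \<sigma>[OF that] yx_config[OF that] by (simp add: proj_def)
    moreover have "\<sigma> x1 = e"
    proof -
      have "a x1 j = 0" if "j \<in> S" for j
        using norm_coord[OF x1(1) that] by (auto simp: a_def u_def)
      then have "zx x1 = z" using n2 by (simp add: zx_def fun_eq_iff)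
      then have "yx x1 = y1" using g by (auto simp: yx_def gaps_def fun_eq_iff)
      then have "y' x1 = c" using wc by (simp add: y'_def)
      moreover have "psi T c = c" using cS by (intro psi_nonneg) (auto simp: T_def)
      ultimately show ?thesis unfolding \<sigma>_def w(2)[symmetric] by (simp add: fold_refl_rev)
    qed
    moreover have "continuous_map (subtopology ?Q V) (top_of_set slice) \<sigma>"
    proof (rule continuous_map_into_subtopology)
      have ca: "continuous_map (subtopology ?Q V) euclideanreal (\<lambda>x. a x j)" if j: "j \<in> S" for j
      proof -
        have "continuous_map ?Q euclidean (\<lambda>x. coord x j)" by (rule continuous_map_coord[OF j])
        moreover have "coord x1 j \<noteq> 0" using norm_coord[OF x1(1) j] by auto
        then have "continuous_on UNIV (\<lambda>z. z / coord x1 j)" by (intro continuous_intros) auto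
        ultimately have "continuous_map ?Q euclidean (\<lambda>x. u x j)"
          using continuous_map_compose[of ?Q euclidean "\<lambda>x. coord x j" euclidean "\<lambda>z. z / coord x1 j"]
          by (simp add: u_def o_def)
        then have "continuous_map (subtopology ?Q V) (top_of_set {z. 0 < Re z}) (\<lambda>x. u x j)"
        proof (intro continuous_map_into_subtopology continuous_map_from_subtopology)
          have "0 < Re (u x j)" if "x \<in> V" for x
            using u(2)[OF that j] \<rho>(4) abs_Re_le_cmod[of "u x j - 1"] by simp
          then show "(\<lambda>x. u x j) \<in> topspace (subtopology ?Q V) \<rightarrow> {z. 0 < Re z}" by auto
        qed
        moreover have "continuous_on {z. 0 < Re z} (\<lambda>z. Arg z / (2 * pi))"
          by (intro continuous_intros continuous_at_imp_continuous_on ballI continuous_at_Arg)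
            (auto simp: complex_nonpos_Reals_iff)
        ultimately show ?thesis
          using continuous_map_compose[of _ "top_of_set {z. 0 < Re z}" "\<lambda>x. u x j" euclideanreal "\<lambda>z. Arg z / (2 * pi)"]
          by (simp add: a_def o_def)
      qed
      have "continuous_map (subtopology ?Q V) euclidean yx"
      proof (rule continuous_map_euclidean_fun)
        fix s
        show "continuous_map (subtopology ?Q V) euclideanreal (\<lambda>x. yx x s)"
          using n2 unfolding yx_def zx_def
          by (cases "s \<in> S") (auto intro!: continuous_intros ca)
      qed
      moreover have "continuous_on UNIV (\<lambda>y. fold (refl 2) (rev w) (psi T (fold (refl 1) w y)))"
        by (intro continuous_intros continuous_on_id)
      ultimately show "continuous_map (subtopology ?Q V) euclidean \<sigma>"
        using continuous_map_compose[of _ euclidean yx euclidean "\<lambda>y. fold (refl 2) (rev w) (psi T (fold (refl 1) w y))"]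
        by (simp add: \<sigma>_def[abs_def] y'_def o_def)
    qed (use \<sigma>_slice in auto)
    ultimately show ?thesis unfolding x1_def by blast
  qed
  ultimately show ?thesis by blast
qed

sublocale sheeted slice "Q_space n p" proj
proof
  show "continuous_map (top_of_set slice) (Q_space n p) proj"
  proof -
    have "slice \<subseteq> cone" by (auto simp: slice_def)
    then show ?thesis using continuous_map_from_subtopology_mono[OF continuous_map_proj] by blast
  qed
qed (fact proj_sections proj_locally_injective)+

text \<open>The straight-line homotopy to \<open>e\<close> stays in the convex cone, though not in
  \<open>slice\<close>, and is then projected.\<close>

lemma contraction:
  assumes e: "e \<in> slice"
  shows "\<exists>K. continuous_map (prod_topology (top_of_set {0..1::real}) (top_of_set slice)) (Q_space n p) K \<and>
      (\<forall>x\<in>slice. K (0, x) = proj x \<and> K (1, x) = proj e) \<and> (\<forall>s\<in>{0..1}. K (s, e) = proj e)"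
proof -
  define h where "h z i = (1 - fst z) * snd z i + fst z * e i" for z :: "real \<times> (int \<Rightarrow> real)" and i
  let ?P = "prod_topology (top_of_set {0..1::real}) (top_of_set slice)"
  have "continuous_map ?P (top_of_set cone) h"
  proof (rule continuous_map_into_subtopology)
    have fst: "continuous_map ?P euclideanreal fst"
      using continuous_map_fst continuous_map_into_fulltopology by blast
    have "continuous_map ?P euclidean snd"
      using continuous_map_snd continuous_map_into_fulltopology by blast
    then have "continuous_map ?P (product_topology (\<lambda>_. euclidean) UNIV) snd"
      by (simp add: euclidean_product_topology)
    then have "continuous_map ?P euclideanreal (\<lambda>z. snd z i)" for i
      by (simp add: continuous_map_componentwise_UNIV)
    then show "continuous_map ?P euclidean h"
      unfolding h_def using fst by (intro continuous_map_euclidean_fun) (auto intro!: continuous_intros)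
    have "h (s, x) \<in> cone" if "s \<in> {0..1}" "x \<in> slice" for s x
      using cone_convex[of x e s] that e by (simp add: h_def[abs_def] slice_def)
    then show "h \<in> topspace ?P \<rightarrow> cone" by auto
  qed
  from continuous_map_compose[OF this continuous_map_proj]
  have "continuous_map ?P (Q_space n p) (\<lambda>z. proj (h z))" by (simp add: o_def)
  moreover have "h (0, x) = x" "h (1, x) = e" "h (s, e) = e" for s x
    by (auto simp: h_def fun_eq_iff algebra_simps)
  ultimately show ?thesis by (intro exI[of _ "\<lambda>z. proj (h z)"]) simp
qed

text \<open>The witness has all gaps equal and gives equally spaced points.\<close>

lemma Q_space_nonempty: "topspace (Q_space n p) \<noteq> {}"
proof -
  have "(\<lambda>i. if i \<in> S then 1 else 0) \<in> chamber" using supp by (auto simp: chamber_def)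
  then have "proj (\<lambda>i. if i \<in> S then 1 else 0) \<in> topspace (Q_space n p)"
    unfolding proj_def by (intro config_develop_in_Q) (simp add: chamber_iff)
  then show ?thesis by blast
qed

end

text \<open>This serves n = 1, where the torus is a point. The single gap would be its own neighbour
  there, which an irreflexive graph does not allow.\<close>

lemma singleton_aspherical:
  assumes "topspace X = {q}"
  shows "eilenberg_maclane X q (homotopy_group 1 X q) 1"
  unfolding eilenberg_maclane_def
proof (intro conjI allI impI)
  show "path_connected_space X"
    using assms unfolding path_connected_space_def
    by (auto intro!: exI[of _ "\<lambda>_. q"] simp: pathin_def)
  fix k :: nat assume "1 \<le> k"
  show "trivial_group (homotopy_group k X q)"
  proof (rule trivial_homotopy_group)
    fix f assume f: "f \<in> spheroids k X q"
    then have "f t = q" if "t \<in> topspace (cube k)" for t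
      using continuous_map_funspace[of "cube k" X f] that assms by (auto simp: spheroids_def Pi_iff)
    then have "homotopic_with (\<lambda>h. \<forall>t\<in>cube_boundary k. h t = q) (cube k) X f (\<lambda>_. q)"
      using f cube_boundary_subset assms
      by (intro homotopic_with_equal) (auto simp: spheroids_def)
    then show "(f, \<lambda>_. q) \<in> spheroid_homotopy k X q" by (simp add: spheroid_homotopy_def)
  qed (use assms \<open>1 \<le> k\<close> in auto)
qed (use assms in auto)

theorem theorem5:
  fixes n :: nat and p :: complex
  assumes "n \<ge> 1" and "p \<in> circle"
  shows "topspace (Q_space n p) \<noteq> {} \<and>
    (\<forall>q \<in> topspace (Q_space n p).
       eilenberg_maclane (Q_space n p) q (homotopy_group 1 (Q_space n p) q) 1)"
proof (cases "n = 1")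
  case True
  have "triple_diagonals n p = {}" using True by (auto simp: triple_diagonals_def)
  then have "topspace (Q_space n p) = {\<lambda>_. undefined}"
    using True by (simp add: Q_space_def torus_def)
  then show ?thesis using singleton_aspherical by fastforce
next
  case False
  interpret cyclic_configurations n p
    using assms False by unfold_locales auto
  show ?thesis using Q_space_nonempty aspherical[OF proj_surj _ contraction] by blast
qed

end
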